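(* Among the non-primitive subgroups $(Q_1),(Q_4),(Q_5)$ (isomorphic to $\mathfrak{A}_5$), $(R_3)$ (isomorphic to $\mathfrak{S}_5$), $(Q_7)$ (isomorphic to $\mathfrak{A}_6$) and $(P)$ (isomorphic to $\operatorname{PSL}_2(\mathbb{F}_7)$) of $\operatorname{PGL}_4(\mathbb{C})$, the group $(P)$ is the only one that leaves smooth quartic surfaces in $\mathbb{P}^3$ invariant. Moreover, the smooth quartic surfaces invariant by $(P)$ are in the pencil of quartics $$\{\lambda_0x_0^4+\lambda_1(x_2x_1^3+x_3^3x_1+x_2^3x_3)=0\},\qquad[\lambda_0:\lambda_1]\in\mathbb{P}^1,$$ whose singular fibers are those at the points $[1:0],[0:1]\in\mathbb{P}^1_{\lambda_0,\lambda_1}$.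
   Context: For $A\in\operatorname{GL}_4(\mathbb{C})$, $(A)$ denotes its class in $\operatorname{PGL}_4(\mathbb{C})$. A surface $X=\{f=0\}\subset\mathbb{P}^3$ is $G$-invariant if $(A)X=X$ for all $(A)\in G$. A member of the pencil is singular if its defining form is singular (all partial derivatives have a common zero in $\mathbb{P}^3$). Let $\omega$ be a primitive 3rd root of unity, $\zeta=e^{2\pi i/7}$, $s_-=\zeta^2-\zeta^5$, $t_-=\zeta^4-\zeta^3$, $u_-=\zeta-\zeta^6$, $\lambda_\pm=(-1\pm i\sqrt{15})/4$, $\nu_\pm=(\sqrt3\pm i\sqrt5)/(2\sqrt2)$. The groups are generated by the classes of the following matrices (rows separated by semicolons). Up to conjugation they are all the non-primitive faithful representations in $\operatorname{PGL}_4(\mathbb{C})$ of $\mathfrak{A}_5,\mathfrak{S}_5,\mathfrak{A}_6,\operatorname{PSL}_2(\mathbb{F}_7)$. $(Q_1)$: $\operatorname{diag}(1,1,\omega,\omega^2)$, $[1,0,0,0;0,-\frac13,\frac23,\frac23;0,\frac23,-\frac13,\frac23;0,\frac23,\frac23,-\frac13]$, $[1,0,0,0;0,-1,0,0;0,0,0,\lambda_+;0,0,\lambda_-,0]$. $(Q_4)$: $Q_{41}=\operatorname{diag}(\omega,\omega,\omega^2,\omega^2)$, $Q_{42}=\frac1{\sqrt3}[1,0,0,\sqrt2;0,1,\sqrt2,0;0,\sqrt2,-1,0;\sqrt2,0,0,-1]$, $Q_{43}=[0,0,0,\nu_+;0,0,\nu_+,0;0,\nu_-,0,0;\nu_-,0,0,0]$.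 $(Q_5)$: $Q_{41}$, $Q_{42}$, $Q_{53}=[0,0,0,\nu_+;0,0,\nu_-,0;0,\nu_+,0,0;\nu_-,0,0,0]$. $(R_3)$: $(Q_5)$ and $[0,0,1,0;0,0,0,-1;1,0,0,0;0,-1,0,0]$. $(Q_7)$: $(Q_5)$ and $\frac1{\sqrt5}[0,0,\sqrt3,i\sqrt2;0,0,-i\sqrt2,-\sqrt3;\sqrt3,i\sqrt2,0,0;-i\sqrt2,-\sqrt3,0,0]$. $(P)$: $\tilde S=\operatorname{diag}(1,\zeta^4,\zeta^2,\zeta)$, $\tilde T=[1,0,0,0;0,0,1,0;0,0,0,1;0,1,0,0]$, $\tilde R=\frac{i}{\sqrt7}[-i\sqrt7,0,0,0;0,u_-,s_-,t_-;0,s_-,t_-,u_-;0,t_-,u_-,s_-]$. *)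

theory Defs
  imports
    "HOL-Analysis.Analysis"
    "HOL-Library.Poly_Mapping"
    "HOL-Algebra.Generated_Groups"
begin

section \<open>Forms in four variables\<close>

text \<open>
  Coordinates are indexed by the library type \<^typ>\<open>4\<close>, whose elements are 1, 2, 3 and 4 (= 0), in
  the order used by \<^const>\<open>vector\<close>. The coordinate usually written x_k (k = 0, ..., 3) has index
  k + 1. A polynomial is the finitely supported map from exponent
  vectors to coefficients.
\<close>

type_synonym quad_poly = "(4 \<Rightarrow>\<^sub>0 nat) \<Rightarrow>\<^sub>0 complex"

definition pvar :: "4 \<Rightarrow> quad_poly" where
  "pvar i = Poly_Mapping.single (Poly_Mapping.single i 1) 1"

definition pconst :: "complex \<Rightarrow> quad_poly" where
  "pconst c = Poly_Mapping.single 0 c"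

definition peval :: "quad_poly \<Rightarrow> complex^4 \<Rightarrow> complex" where
  "peval f x =
     (\<Sum>m\<in>Poly_Mapping.keys f. Poly_Mapping.lookup f m * (\<Prod>i\<in>UNIV. x $ i ^ Poly_Mapping.lookup m i))"

text \<open>
  Formal partial derivative. The truncated subtraction for exponent 0 is harmless, since that term
  has coefficient 0.
\<close>

definition pderiv_wrt :: "4 \<Rightarrow> quad_poly \<Rightarrow> quad_poly" where
  "pderiv_wrt i f =
     (\<Sum>m\<in>Poly_Mapping.keys f. Poly_Mapping.single (m - Poly_Mapping.single i 1)
        (of_nat (Poly_Mapping.lookup m i) * Poly_Mapping.lookup f m))"

definition quartic_form :: "quad_poly \<Rightarrow> bool" where
  "quartic_form f \<longleftrightarrow>
     f \<noteq> 0 \<and> (\<forall>m\<in>Poly_Mapping.keys f. (\<Sum>i\<in>UNIV. Poly_Mapping.lookup m i) = 4)"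

definition singular_form :: "quad_poly \<Rightarrow> bool" where
  "singular_form f \<longleftrightarrow> (\<exists>x. x \<noteq> 0 \<and> (\<forall>i. peval (pderiv_wrt i f) x = 0))"

definition smooth_quartic :: "quad_poly \<Rightarrow> bool" where
  "smooth_quartic f \<longleftrightarrow> quartic_form f \<and> \<not> singular_form f"

section \<open>Projective space and the projective linear group\<close>

text \<open>A point of projective space is a line through the origin, with the origin removed.\<close>

definition proj_point :: "complex^'n \<Rightarrow> (complex^'n) set" where
  "proj_point x = {c *s x | c. c \<noteq> 0}"

definition surface :: "quad_poly \<Rightarrow> (complex^4) set set" where
  "surface f = {proj_point x | x. x \<noteq> 0 \<and> peval f x = 0}"

definition GL :: "(complex^'n^'n) monoid" where
  "GL = \<lparr>carrier = {A. invertible A}, monoid.mult = (**), one = mat 1\<rparr>"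

definition scalar_matrices :: "(complex^'n^'n) set" where
  "scalar_matrices = {mat c | c. c \<noteq> 0}"

definition PGL :: "(complex^'n^'n) set monoid" where
  "PGL = GL Mod scalar_matrices"

definition pgl_class :: "complex^'n^'n \<Rightarrow> (complex^'n^'n) set" where
  "pgl_class A = scalar_matrices #>\<^bsub>GL\<^esub> A"

definition proj_map :: "complex^'n^'n \<Rightarrow> (complex^'n) set \<Rightarrow> (complex^'n) set" where
  "proj_map A p = (\<lambda>x. A *v x) ` p"

definition invariant_under :: "(complex^'n^'n) set set \<Rightarrow> (complex^'n) set set \<Rightarrow> bool" where
  "invariant_under G X \<longleftrightarrow> (\<forall>A. invertible A \<and> pgl_class A \<in> G \<longrightarrow> proj_map A ` X = X)"

definition pgl_generated :: "(complex^'n^'n) set \<Rightarrow> (complex^'n^'n) set set" where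
  "pgl_generated S = generate PGL (pgl_class ` S)"

section \<open>The groups\<close>

definition primitive_root_of_unity :: "nat \<Rightarrow> complex \<Rightarrow> bool" where
  "primitive_root_of_unity n z \<longleftrightarrow> n > 0 \<and> z ^ n = 1 \<and> (\<forall>k. 0 < k \<and> k < n \<longrightarrow> z ^ k \<noteq> 1)"

definition rsqrt :: "real \<Rightarrow> complex" where
  "rsqrt x = complex_of_real (sqrt x)"

definition mat4 ::
  "complex list \<Rightarrow> complex list \<Rightarrow> complex list \<Rightarrow> complex list \<Rightarrow> complex^4^4" where
  "mat4 r0 r1 r2 r3 = vector [vector r0, vector r1, vector r2, vector r3]"

definition scale_mat :: "complex \<Rightarrow> complex^4^4 \<Rightarrow> complex^4^4" where
  "scale_mat c A = (\<chi> i j. c * A $ i $ j)"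

definition lambda_plus :: complex where "lambda_plus = (- 1 + \<i> * rsqrt 15) / 4"
definition lambda_minus :: complex where "lambda_minus = (- 1 - \<i> * rsqrt 15) / 4"
definition nu_plus :: complex where "nu_plus = (rsqrt 3 + \<i> * rsqrt 5) / (2 * rsqrt 2)"
definition nu_minus :: complex where "nu_minus = (rsqrt 3 - \<i> * rsqrt 5) / (2 * rsqrt 2)"

definition zeta7 :: complex where "zeta7 = exp (2 * of_real pi * \<i> / 7)"
definition s_minus :: complex where "s_minus = zeta7 ^ 2 - zeta7 ^ 5"
definition t_minus :: complex where "t_minus = zeta7 ^ 4 - zeta7 ^ 3"
definition u_minus :: complex where "u_minus = zeta7 - zeta7 ^ 6"

definition group_Q1 :: "complex \<Rightarrow> (complex^4^4) set set" where
  "group_Q1 \<omega> = pgl_generated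
    {mat4 [1, 0, 0, 0]
          [0, 1, 0, 0]
          [0, 0, \<omega>, 0]
          [0, 0, 0, \<omega> ^ 2],
     mat4 [1, 0, 0, 0]
          [0, - (1/3), 2/3, 2/3]
          [0, 2/3, - (1/3), 2/3]
          [0, 2/3, 2/3, - (1/3)],
     mat4 [1, 0, 0, 0]
          [0, - 1, 0, 0]
          [0, 0, 0, lambda_plus]
          [0, 0, lambda_minus, 0]}"

definition Q41 :: "complex \<Rightarrow> complex^4^4" where
  "Q41 \<omega> = mat4 [\<omega>, 0, 0, 0]
                  [0, \<omega>, 0, 0]
                  [0, 0, \<omega> ^ 2, 0]
                  [0, 0, 0, \<omega> ^ 2]"

definition Q42 :: "complex^4^4" where
  "Q42 = scale_mat (1 / rsqrt 3)
     (mat4 [1, 0, 0, rsqrt 2]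
           [0, 1, rsqrt 2, 0]
           [0, rsqrt 2, - 1, 0]
           [rsqrt 2, 0, 0, - 1])"

definition Q43 :: "complex^4^4" where
  "Q43 = mat4 [0, 0, 0, nu_plus]
              [0, 0, nu_plus, 0]
              [0, nu_minus, 0, 0]
              [nu_minus, 0, 0, 0]"

definition Q53 :: "complex^4^4" where
  "Q53 = mat4 [0, 0, 0, nu_plus]
              [0, 0, nu_minus, 0]
              [0, nu_plus, 0, 0]
              [nu_minus, 0, 0, 0]"

definition group_Q4 :: "complex \<Rightarrow> (complex^4^4) set set" where
  "group_Q4 \<omega> = pgl_generated {Q41 \<omega>, Q42, Q43}"

definition group_Q5 :: "complex \<Rightarrow> (complex^4^4) set set" where
  "group_Q5 \<omega> = pgl_generated {Q41 \<omega>, Q42, Q53}"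

definition group_R3 :: "complex \<Rightarrow> (complex^4^4) set set" where
  "group_R3 \<omega> = pgl_generated
    {Q41 \<omega>, Q42, Q53,
     mat4 [0, 0, 1, 0]
          [0, 0, 0, - 1]
          [1, 0, 0, 0]
          [0, - 1, 0, 0]}"

definition group_Q7 :: "complex \<Rightarrow> (complex^4^4) set set" where
  "group_Q7 \<omega> = pgl_generated
    {Q41 \<omega>, Q42, Q53,
     scale_mat (1 / rsqrt 5)
       (mat4 [0, 0, rsqrt 3, \<i> * rsqrt 2]
             [0, 0, - (\<i> * rsqrt 2), - rsqrt 3]
             [rsqrt 3, \<i> * rsqrt 2, 0, 0]
             [- (\<i> * rsqrt 2), - rsqrt 3, 0, 0])}"

definition group_P :: "(complex^4^4) set set" where
  "group_P = pgl_generated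
    {mat4 [1, 0, 0, 0]
          [0, zeta7 ^ 4, 0, 0]
          [0, 0, zeta7 ^ 2, 0]
          [0, 0, 0, zeta7],
     mat4 [1, 0, 0, 0]
          [0, 0, 1, 0]
          [0, 0, 0, 1]
          [0, 1, 0, 0],
     scale_mat (\<i> / rsqrt 7)
       (mat4 [- (\<i> * rsqrt 7), 0, 0, 0]
             [0, u_minus, s_minus, t_minus]
             [0, s_minus, t_minus, u_minus]
             [0, t_minus, u_minus, s_minus])}"

section \<open>The pencil\<close>

definition pencil :: "complex^2 \<Rightarrow> quad_poly" where
  "pencil l =
     (let x0 = pvar 1; x1 = pvar 2; x2 = pvar 3; x3 = pvar 4
      in pconst (l $ 1) * x0 ^ 4 + pconst (l $ 2) * (x2 * x1 ^ 3 + x3 ^ 3 * x1 + x2 ^ 3 * x3))"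

end

theory Submission
  imports Defs "HOL-Computational_Algebra.Fundamental_Theorem_Algebra"
begin

text \<open>
  If a smooth quartic surface is invariant under a linear map, its form is multiplied by a constant:
  a general line meets the surface in four distinct points, and these determine the restriction of a
  quartic form to the line up to a factor. Invariance under a group is thereby a system of linear
  conditions on the coefficients of the form. For the groups other than \<open>(P)\<close> the solutions are
  singular at an explicit point; for \<open>(Q\<^sub>4)\<close> and \<open>(Q\<^sub>5)\<close>, hence also for \<open>(R\<^sub>3)\<close> and \<open>(Q\<^sub>7)\<close>,
  they are multiples of the square of a quadric. For \<open>(P)\<close> the diagonal generator leaves five
  monomials, and the other two generators reduce them to the pencil.
\<close>

section \<open>Values and derivatives of forms\<close>

text \<open>Invariance concerns point sets only; smoothness is what makes the forms themselves
  comparable. All lines in the rigidity argument share one direction \<open>b\<close> off the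
  surface: the top coefficient on each line is the value at \<open>b\<close>, so the factor is the
  same for all lines, and the intersection points stay bounded when the line moves. A given line may
  be tangent; by smoothness it can be shifted in a direction along which the form changes to first
  order at each of its zeros, and this splits multiple roots. The factor of a generator must be
  known before monomials can be excluded. For (Q_1) and (P) all generators fix (1, 0, 0, 0): either
  the form is nonzero there and every factor is 1, or its gradient there vanishes. For (Q_4) and
  (Q_5) the antidiagonal generator conjugates the diagonal one to its square, so that the factor of
  the latter is 1.\<close>

abbreviation monomial_value :: "(4 \<Rightarrow>\<^sub>0 nat) \<Rightarrow> complex^4 \<Rightarrow> complex" where
  "monomial_value m x \<equiv> (\<Prod>i\<in>UNIV. x $ i ^ Poly_Mapping.lookup m i)"

lemma prod_4: "prod f (UNIV::4 set) = f 1 * f 2 * f 3 * f 4"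
  unfolding UNIV_4 by (simp add: ac_simps)

lemma vector_4_nth [simp]:
  "(vector [a, b, c, d] :: 'a::zero^4) $ 1 = a"
  "(vector [a, b, c, d] :: 'a::zero^4) $ 2 = b"
  "(vector [a, b, c, d] :: 'a::zero^4) $ 3 = c"
  "(vector [a, b, c, d] :: 'a::zero^4) $ 4 = d"
  unfolding vector_def by simp_all

lemma peval_superset:
  assumes "finite S" "Poly_Mapping.keys f \<subseteq> S"
  shows "peval f x = (\<Sum>m\<in>S. Poly_Mapping.lookup f m * monomial_value m x)"
  unfolding peval_def using assms
  by (intro sum.mono_neutral_left) (auto simp: in_keys_iff)

lemma peval_single [simp]: "peval (Poly_Mapping.single m c) x = c * monomial_value m x"
  by (subst peval_superset[of "{m}"]) auto

lemma peval_add [simp]: "peval (f + g) x = peval f x + peval g x"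
proof -
  let ?S = "Poly_Mapping.keys f \<union> Poly_Mapping.keys g"
  have "Poly_Mapping.keys (f + g) \<subseteq> ?S" by (rule keys_add)
  then show ?thesis
    by (simp add: peval_superset[of ?S] lookup_add distrib_right sum.distrib)
qed

lemma peval_0 [simp]: "peval 0 x = 0"
  by (simp add: peval_def)

lemma peval_sum: "peval (sum f I) x = (\<Sum>i\<in>I. peval (f i) x)"
  by (induction I rule: infinite_finite_induct) auto

lemma monomial_value_scale:
  "monomial_value m (c *s x) = c ^ (\<Sum>i\<in>UNIV. Poly_Mapping.lookup m i) * monomial_value m x"
  by (simp add: power_mult_distrib prod.distrib power_sum)

lemma quartic_form_scale:
  assumes "quartic_form f"
  shows "peval f (c *s x) = c ^ 4 * peval f x"
  using assms unfolding peval_def monomial_value_scale quartic_form_def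
  by (simp add: sum_distrib_left mult_ac)

lemma base_expansion_inj:
  fixes N :: nat
  assumes "a < N" "a' < N" "a + N * b = a' + N * b'"
  shows "a = a' \<and> b = b'"
proof -
  have "(a + N * b) mod N = a" "(a' + N * b') mod N = a'" by (simp_all add: assms(1,2))
  then have "a = a'" using assms(3) by simp
  with assms show ?thesis by auto
qed

text \<open>
  Kronecker substitution: putting \<open>x\<^sub>i = t ^ N ^ (i - 1)\<close> with \<open>N\<close> larger than every exponent
  separates the monomials.
\<close>

lemma monomials_independent:
  fixes c :: "(4 \<Rightarrow>\<^sub>0 nat) \<Rightarrow> complex"
  assumes fin: "finite S" and zero: "\<And>x. (\<Sum>m\<in>S. c m * monomial_value m x) = 0" and m: "m \<in> S"
  shows "c m = 0"
proof -
  let ?l = "Poly_Mapping.lookup"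
  define N where "N = Suc (\<Sum>m\<in>S. \<Sum>i\<in>UNIV. ?l m i)"
  have less: "?l m' i < N" if "m' \<in> S" for m' i
  proof -
    have "?l m' i \<le> (\<Sum>i\<in>UNIV. ?l m' i)" by (rule member_le_sum) auto
    also have "\<dots> \<le> (\<Sum>m\<in>S. \<Sum>i\<in>UNIV. ?l m i)" using that fin
      by (intro member_le_sum) auto
    finally show ?thesis by (simp add: N_def)
  qed
  define e where "e m' = ?l m' 1 + N * (?l m' 2 + N * (?l m' 3 + N * ?l m' 4))" for m' :: "4 \<Rightarrow>\<^sub>0 nat"
  have inj: "m' = m''" if "m' \<in> S" "m'' \<in> S" "e m' = e m''" for m' m''
  proof -
    from that(3) have "?l m' 1 = ?l m'' 1 \<and> ?l m' 2 = ?l m'' 2 \<and> ?l m' 3 = ?l m'' 3 \<and> ?l m' 4 = ?l m'' 4"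
      unfolding e_def using less[OF that(1)] less[OF that(2)]
      by (metis base_expansion_inj)
    then show ?thesis by (intro poly_mapping_eqI) (metis exhaust_4)
  qed
  define p where "p = (\<Sum>m\<in>S. monom (c m) (e m))"
  have "poly p t = 0" for t
  proof -
    have "monomial_value m' (vector [t, t ^ N, t ^ (N * N), t ^ (N * (N * N))]) = t ^ e m'" for m'
      unfolding prod_4 vector_4_nth e_def
      by (simp add: power_add power_mult[symmetric] distrib_left mult_ac)
    then show ?thesis using zero[of "vector [t, t ^ N, t ^ (N * N), t ^ (N * (N * N))]"]
      by (simp add: p_def poly_sum poly_monom)
  qed
  then have "p = 0" using poly_all_0_iff_0 by blast
  then have "0 = coeff p (e m)" by simp
  also have "\<dots> = (\<Sum>m'\<in>S. if m' = m then c m' else 0)"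
    unfolding p_def coeff_sum by (intro sum.cong) (use inj m in auto)
  also have "\<dots> = c m" using fin m by simp
  finally show ?thesis by simp
qed

text \<open>Membership in the pencil is an equality of formal polynomials, whereas invariance yields
  identities between values; this is the passage from one to the other.\<close>

lemma peval_eq_imp_eq:
  assumes "\<And>x. peval f x = peval g x"
  shows "f = g"
proof (rule poly_mapping_eqI)
  fix m
  let ?S = "Poly_Mapping.keys f \<union> Poly_Mapping.keys g \<union> {m}"
  have "Poly_Mapping.lookup f m - Poly_Mapping.lookup g m = 0"
  proof (rule monomials_independent[where S = ?S])
    fix x
    show "(\<Sum>m\<in>?S. (Poly_Mapping.lookup f m - Poly_Mapping.lookup g m) * monomial_value m x) = 0"
      unfolding left_diff_distrib sum_subtractf
      using assms[of x] by (subst (1 2) peval_superset[symmetric]) auto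
  qed auto
  then show "Poly_Mapping.lookup f m = Poly_Mapping.lookup g m" by simp
qed

lemma peval_pderiv_wrt:
  "peval (pderiv_wrt i f) x = (\<Sum>m\<in>Poly_Mapping.keys f. Poly_Mapping.lookup f m *
     (of_nat (Poly_Mapping.lookup m i) * monomial_value (m - Poly_Mapping.single i 1) x))"
  unfolding pderiv_wrt_def peval_sum by (simp add: mult_ac)

lemma monomial_value_deriv:
  "((\<lambda>s. monomial_value m (x + s *s v)) has_field_derivative
     (\<Sum>i\<in>UNIV. v $ i * (of_nat (Poly_Mapping.lookup m i) * monomial_value (m - Poly_Mapping.single i 1) x))) (at 0)"
  unfolding prod_4 sum_4
  by (auto intro!: derivative_eq_intros simp: lookup_minus lookup_single when_def algebra_simps)

text \<open>The bridge from formal partial derivatives to analysis: later on, partial derivatives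
  are computed through uniqueness of the derivative along a line.\<close>

lemma peval_deriv:
  "((\<lambda>s. peval f (x + s *s v)) has_field_derivative
     (\<Sum>i\<in>UNIV. v $ i * peval (pderiv_wrt i f) x)) (at 0)"
proof -
  have "((\<lambda>s. peval f (x + s *s v)) has_field_derivative
     (\<Sum>m\<in>Poly_Mapping.keys f. Poly_Mapping.lookup f m * (\<Sum>i\<in>UNIV. v $ i *
       (of_nat (Poly_Mapping.lookup m i) * monomial_value (m - Poly_Mapping.single i 1) x)))) (at 0)"
    unfolding peval_def by (intro DERIV_sum DERIV_cmult monomial_value_deriv)
  also have "(\<Sum>m\<in>Poly_Mapping.keys f. Poly_Mapping.lookup f m * (\<Sum>i\<in>UNIV. v $ i *
       (of_nat (Poly_Mapping.lookup m i) * monomial_value (m - Poly_Mapping.single i 1) x))) =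
     (\<Sum>i\<in>UNIV. v $ i * peval (pderiv_wrt i f) x)"
    unfolding peval_pderiv_wrt sum_distrib_left by (subst sum.swap) (simp add: mult_ac)
  finally show ?thesis .
qed

section \<open>Rigidity of smooth quartics\<close>

lemma coeff_mult_top:
  fixes p q :: "'a::idom poly"
  assumes "degree p \<le> m" "degree q \<le> n"
  shows "coeff (p * q) (m + n) = coeff p m * coeff q n"
proof (cases "degree p = m \<and> degree q = n")
  case True
  then show ?thesis using coeff_mult_degree_sum[of p q] by simp
next
  case False
  with assms have "degree p + degree q < m + n" by auto
  then have "coeff (p * q) (m + n) = 0"
    using degree_mult_le[of p q] by (intro coeff_eq_0) linarith
  moreover have "coeff p m = 0 \<or> coeff q n = 0"
    using False assms by (metis coeff_eq_0 le_neq_implies_less)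
  ultimately show ?thesis by auto
qed

lemma linear_power_top: "degree ([:a, b:] ^ n) \<le> n \<and> coeff ([:a, b:] ^ n) n = (b::'a::idom) ^ n"
proof (induction n)
  case (Suc n)
  have d: "degree [:a, b:] \<le> 1" by simp
  have "degree ([:a, b:] ^ Suc n) \<le> Suc n"
    using degree_mult_le[of "[:a, b:]" "[:a, b:] ^ n"] Suc d by simp
  then show ?case using coeff_mult_top[OF d, of "[:a, b:] ^ n" n] Suc by simp
qed simp

lemma prod_top:
  fixes p :: "'i \<Rightarrow> 'a::idom poly"
  assumes "\<And>i. degree (p i) \<le> n i"
  shows "degree (\<Prod>i\<in>I. p i) \<le> (\<Sum>i\<in>I. n i) \<and>
    coeff (\<Prod>i\<in>I. p i) (\<Sum>i\<in>I. n i) = (\<Prod>i\<in>I. coeff (p i) (n i))"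
proof (induction I rule: infinite_finite_induct)
  case (insert x F)
  have "degree (p x * prod p F) \<le> n x + sum n F"
    using degree_mult_le[of "p x" "prod p F"] insert assms[of x] by linarith
  then show ?case using insert coeff_mult_top[OF assms, of "prod p F" "sum n F" x] by simp
qed auto

text \<open>The coefficient of t^4 is the value at the point at infinity \<open>b\<close> of the
  line. It may be 0, and some factors may be constant in t, hence degree bounds instead of exact
  degrees.\<close>

lemma quartic_form_on_line:
  assumes "quartic_form f"
  obtains p where "degree p \<le> 4" "coeff p 4 = peval f b" "\<And>t. poly p t = peval f (a + t *s b)"
proof
  let ?l = "Poly_Mapping.lookup"
  let ?q = "\<lambda>m. \<Prod>i\<in>UNIV. [:a $ i, b $ i:] ^ ?l m i"
  let ?p = "\<Sum>m\<in>Poly_Mapping.keys f. smult (?l f m) (?q m)"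
  have q: "degree (?q m) \<le> 4 \<and> coeff (?q m) 4 = monomial_value m b"
    if "m \<in> Poly_Mapping.keys f" for m
    using prod_top[of "\<lambda>i. [:a $ i, b $ i:] ^ ?l m i" "?l m" UNIV] linear_power_top that assms
    unfolding quartic_form_def by auto
  show "degree ?p \<le> 4"
    by (intro degree_sum_le) (auto intro: order.trans[OF degree_smult_le] simp: q)
  show "coeff ?p 4 = peval f b"
    unfolding coeff_sum peval_def by (intro sum.cong) (auto simp: q)
  show "poly ?p t = peval f (a + t *s b)" for t
    by (simp add: peval_def poly_sum poly_prod mult.commute)
qed

text \<open>The outer variable is s and the inner one t: evaluation at the constant polynomial
  \<open>[:s:]\<close> gives one line of the plane as a polynomial in t, and \<open>pCons\<close>
  splits off the line s = 0.\<close>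

lemma plane_section:
  obtains Q :: "complex poly poly"
  where "\<And>s t. poly (poly Q [:s:]) t = peval f (a + s *s v + t *s b)"
proof
  let ?l = "Poly_Mapping.lookup"
  let ?Q = "\<Sum>m\<in>Poly_Mapping.keys f. [:[:?l f m:]:] * (\<Prod>i\<in>UNIV. [:[:a $ i, b $ i:], [:v $ i:]:] ^ ?l m i)"
  show "poly (poly ?Q [:s:]) t = peval f (a + s *s v + t *s b)" for s t
    by (simp add: peval_def poly_sum poly_prod algebra_simps)
qed

lemma continuous_poly_poly:
  "continuous_on UNIV (\<lambda>z::complex \<times> complex. poly (poly H [:fst z:]) (snd z))"
  by (induction H) (auto intro!: continuous_intros)

lemma tendsto_poly_poly:
  assumes "s \<longlonglongrightarrow> (s0::complex)" "t \<longlonglongrightarrow> t0"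
  shows "(\<lambda>n. poly (poly H [:s n:]) (t n)) \<longlonglongrightarrow> poly (poly H [:s0:]) t0"
proof -
  have "isCont (\<lambda>z::complex \<times> complex. poly (poly H [:fst z:]) (snd z)) (s0, t0)"
    using continuous_poly_poly continuous_on_eq_continuous_at by blast
  from isCont_tendsto_compose[OF this tendsto_Pair[OF assms]] show ?thesis by simp
qed

lemma pderiv_poly_const: "pderiv (poly H [:s:]) = poly (map_poly pderiv H) [:s::complex:]"
  by (induction H) (auto simp: map_poly_pCons pderiv_add pderiv_smult)

text \<open>
  Write \<open>P = (X - t0) ^ Suc k * U\<close>. Eliminating \<open>s\<close> from the two equations for a double root
  \<open>t0 + e\<close> of \<open>P + s h\<close> leaves \<open>e ^ k * (Suc k * h * U + O(e)) = 0\<close>.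
\<close>

lemma no_double_roots_near_zero:
  fixes P :: "complex poly" and H :: "complex poly poly"
  assumes s: "s \<longlonglongrightarrow> 0" "\<And>n. s n \<noteq> 0" and t: "t \<longlonglongrightarrow> t0"
    and root: "\<And>n. poly (poly (pCons P H) [:s n:]) (t n) = 0"
    and double: "\<And>n. poly (pderiv (poly (pCons P H) [:s n:])) (t n) = 0"
    and "P \<noteq> 0" and transversal: "poly P t0 = 0 \<Longrightarrow> poly (poly H 0) t0 \<noteq> 0"
  shows False
proof -
  define h where "h n = poly (poly H [:s n:]) (t n)" for n
  define h' where "h' n = poly (poly (map_poly pderiv H) [:s n:]) (t n)" for n
  have h: "h \<longlonglongrightarrow> poly (poly H [:0:]) t0" and h': "h' \<longlonglongrightarrow> poly (poly (map_poly pderiv H) [:0:]) t0"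
    unfolding h_def h'_def by (intro tendsto_poly_poly s t)+
  have eq: "poly P (t n) + s n * h n = 0" "poly (pderiv P) (t n) + s n * h' n = 0" for n
    using root[of n] double[of n]
    by (simp_all add: h_def h'_def pderiv_add pderiv_smult pderiv_poly_const)
  have "(\<lambda>n. poly P (t n) + s n * h n) \<longlonglongrightarrow> poly P t0 + 0 * poly (poly H [:0:]) t0"
    by (intro tendsto_intros s t h)
  then have P0: "poly P t0 = 0" by (simp add: eq LIMSEQ_const_iff)
  have h0: "poly (poly H [:0:]) t0 \<noteq> 0" using transversal[OF P0] by simp
  obtain U where U: "P = [:- t0, 1:] ^ Polynomial.order t0 P * U" "\<not> [:- t0, 1:] dvd U"
    using order_decomp[OF \<open>P \<noteq> 0\<close>] by blast
  have "Polynomial.order t0 P \<noteq> 0" using P0 \<open>P \<noteq> 0\<close> by (simp add: order_root)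
  then obtain k where k: "Polynomial.order t0 P = Suc k" by (metis not0_implies_Suc)
  define e where "e n = t n - t0" for n
  have e: "e \<longlonglongrightarrow> 0" unfolding e_def using tendsto_diff[OF t tendsto_const[of t0]] by simp
  have P: "poly P (t n) = e n ^ Suc k * poly U (t n)" for n
    by (subst U) (simp add: k e_def del: power_Suc)
  have P': "poly (pderiv P) (t n) = e n ^ k * (of_nat (Suc k) * poly U (t n) + e n * poly (pderiv U) (t n))" for n
    by (subst U, simp only: k pderiv_mult pderiv_power_Suc poly_add poly_mult poly_smult poly_power)
      (simp add: e_def pderiv_pCons algebra_simps)
  define z where "z n = of_nat (Suc k) * poly U (t n) * h n + e n * (poly (pderiv U) (t n) * h n - poly U (t n) * h' n)" for n
  have "z \<longlonglongrightarrow> of_nat (Suc k) * poly U t0 * poly (poly H [:0:]) t0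
      + 0 * (poly (pderiv U) t0 * poly (poly H [:0:]) t0 - poly U t0 * poly (poly (map_poly pderiv H) [:0:]) t0)"
    unfolding z_def by (intro tendsto_intros h h' e t)
  moreover have "of_nat (Suc k) * poly U t0 * poly (poly H [:0:]) t0 \<noteq> 0"
    using U(2) h0 by (auto simp: poly_eq_0_iff_dvd simp del: of_nat_Suc)
  ultimately have "\<forall>\<^sub>F n in sequentially. z n \<noteq> 0"
    by (simp add: tendsto_imp_eventually_ne)
  moreover have "\<forall>\<^sub>F n in sequentially. h n \<noteq> 0"
    using h h0 by (simp add: tendsto_imp_eventually_ne)
  ultimately obtain n where n: "z n \<noteq> 0" "h n \<noteq> 0"
    using eventually_happens'[OF sequentially_bot] eventually_conj by blast
  have "h n * (poly (pderiv P) (t n) + s n * h' n) - h' n * (poly P (t n) + s n * h n) = e n ^ k * z n"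
    unfolding P P' z_def by (simp add: algebra_simps)
  \<comment> \<open>For k = 0 this is already absurd. Otherwise t n = t0, so P vanishes at t n and
    the first equation becomes s n * h n = 0.\<close>
  then have "e n ^ k = 0" using n eq by simp
  then have "e n = 0" by auto
  then show False using eq(1)[of n] n s(2)[of n] by (simp add: P)
qed

text \<open>On the moment curve (1, r, r^2, r^3) the pairing with \<open>w t\<close> is the value at
  r of the polynomial with coefficients \<open>w t\<close>, and finitely many nonzero polynomials
  have a common non-root.\<close>

lemma exists_nonorthogonal:
  fixes w :: "'t \<Rightarrow> 4 \<Rightarrow> complex"
  assumes "finite T" "\<And>t. t \<in> T \<Longrightarrow> \<exists>i. w t i \<noteq> 0"
  obtains v :: "complex^4" where "\<And>t. t \<in> T \<Longrightarrow> (\<Sum>i\<in>UNIV. v $ i * w t i) \<noteq> 0"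
proof -
  define p where "p t = [:w t 1, w t 2, w t 3, w t 4:]" for t
  have "p t \<noteq> 0" if "t \<in> T" for t
    using assms(2)[OF that] unfolding p_def by simp (metis exhaust_4)
  then have "(\<Prod>t\<in>T. p t) \<noteq> 0" using assms(1) by simp
  then obtain r where "poly (\<Prod>t\<in>T. p t) r \<noteq> 0" using poly_all_0_iff_0 by blast
  then have r: "poly (p t) r \<noteq> 0" if "t \<in> T" for t
    using that assms(1) by (simp add: poly_prod)
  show ?thesis
    by (rule that[of "vector [1, r, r ^ 2, r ^ 3]"])
      (use r in \<open>simp add: sum_4 p_def algebra_simps power2_eq_square power3_eq_cube\<close>)
qed

text \<open>A zero with large t would, after division by t, be a zero close to \<open>b\<close>,
  where the form does not vanish.\<close>

lemma bounded_roots: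
  assumes "quartic_form f" "peval f b \<noteq> 0"
  obtains M where "\<And>s t. norm s \<le> 1 \<Longrightarrow> peval f (a + s *s v + t *s b) = 0 \<Longrightarrow> norm t \<le> M"
proof -
  let ?g = "\<lambda>z. peval f (b + fst z *s a + snd z *s v)"
  have "continuous_on UNIV ?g"
    unfolding peval_def by (auto intro!: continuous_intros)
  then have "open (?g -` (- {0}))" by (intro open_vimage) auto
  moreover have "(0, 0) \<in> ?g -` (- {0})" using assms(2) by simp
  ultimately obtain \<delta> where \<delta>: "\<delta> > 0" "ball (0, 0) \<delta> \<subseteq> ?g -` (- {0})"
    using open_contains_ball by blast
  \<comment> \<open>The 2 comes from norm (1 / t) + norm (s / t) <= 2 / norm t.\<close>
  show ?thesis
  proof (rule that[of "2 / \<delta>"], rule ccontr)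
    fix s t assume s: "norm s \<le> 1" and zero: "peval f (a + s *s v + t *s b) = 0"
      and t: "\<not> norm t \<le> 2 / \<delta>"
    then have t0: "norm t > 0" using \<delta>(1) by (smt (verit) divide_pos_pos)
    have small: "2 / norm t < \<delta>" using t t0 \<delta>(1) by (simp add: field_simps)
    have "norm (1 / t, s / t) \<le> norm (1 / t) + norm (s / t)" by (rule norm_Pair_le)
    also have "\<dots> \<le> 2 / norm t" using s t0 by (simp add: norm_divide field_simps)
    finally have "(1 / t, s / t) \<in> ball (0, 0) \<delta>"
      using small by (simp flip: zero_prod_def)
    then have "?g (1 / t, s / t) \<noteq> 0" using \<delta>(2) by blast
    moreover have "a + s *s v + t *s b = t *s (b + (1 / t) *s a + (s / t) *s v)"
      using t0 by (simp add: vec_eq_iff field_simps)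
    ultimately show False using zero t0 by (simp add: quartic_form_scale[OF assms(1)] del: vector_ssub_ldistrib vector_add_ldistrib)
  qed
qed

text \<open>The finitely many zeros on the line s = 0 are nonsingular points, since the line avoids
  the origin; so one direction \<open>v\<close> has nonzero derivative at all of them. Double roots
  on lines with s tending to 0 would accumulate at a root where this is impossible.\<close>

lemma transversal_lines:
  assumes f: "smooth_quartic f" and b: "peval f b \<noteq> 0" and a: "\<And>t. a + t *s b \<noteq> 0"
  obtains v Q where "\<And>s t. poly (poly Q [:s:]) t = peval f (a + s *s v + t *s b)"
    "\<forall>\<^sub>F s in at 0. rsquarefree (poly Q [:s:])"
proof -
  have qf: "quartic_form f" using f by (simp add: smooth_quartic_def)
  obtain p where p: "coeff p 4 = peval f b" "\<And>t. poly p t = peval f (a + t *s b)"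
    using quartic_form_on_line[OF qf] by metis
  define T where "T = {t. peval f (a + t *s b) = 0}"
  have "p \<noteq> 0" using p(1) b by auto
  then have "finite T" unfolding T_def p(2)[symmetric] by (rule poly_roots_finite)
  moreover have "\<exists>i. peval (pderiv_wrt i f) (a + t *s b) \<noteq> 0" for t
    using f a[of t] unfolding smooth_quartic_def singular_form_def by blast
  ultimately obtain v :: "complex^4"
    where v: "\<And>t. t \<in> T \<Longrightarrow> (\<Sum>i\<in>UNIV. v $ i * peval (pderiv_wrt i f) (a + t *s b)) \<noteq> 0"
    by (rule exists_nonorthogonal[of T "\<lambda>t i. peval (pderiv_wrt i f) (a + t *s b)"]) blast
  obtain Q where Q: "\<And>s t. poly (poly Q [:s:]) t = peval f (a + s *s v + t *s b)"
    using plane_section[of f a v b] by blast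
  obtain P H where PH: "Q = pCons P H" by (cases Q)
  have P: "poly P t = peval f (a + t *s b)" for t
    using Q[of 0 t] by (simp add: PH)
  have "P \<noteq> 0" using p(2) P \<open>p \<noteq> 0\<close> poly_eq_poly_eq_iff[of p P] by force
  \<comment> \<open>With Q = P + s H, the constant term of H in s is the derivative of the form in
    direction \<open>v\<close>; both sides are derivatives of the same function at s = 0.\<close>
  have H: "poly (poly H 0) t = (\<Sum>i\<in>UNIV. v $ i * peval (pderiv_wrt i f) (a + t *s b))" for t
  proof (rule DERIV_unique)
    show "((\<lambda>s. peval f (a + t *s b + s *s v)) has_field_derivative
        (\<Sum>i\<in>UNIV. v $ i * peval (pderiv_wrt i f) (a + t *s b))) (at 0)"
      by (rule peval_deriv)
    have "((\<lambda>s. poly P t + s * poly (poly H [:s:]) t) has_field_derivative poly (poly H 0) t) (at 0)"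
    proof -
      have "continuous_on UNIV (\<lambda>s. poly (poly H [:s:]) t)"
        by (induction H) (auto intro!: continuous_intros)
      then have "isCont (\<lambda>s. poly (poly H [:s:]) t) 0"
        using continuous_on_eq_continuous_at by blast
      then have "(\<lambda>s. poly (poly H [:s:]) t) \<midarrow>0\<rightarrow> poly (poly H 0) t"
        by (simp add: isCont_def)
      \<comment> \<open>For s different from 0 the difference quotient is exactly H at s.\<close>
      then show ?thesis unfolding DERIV_def
        by (rule filterlim_cong[THEN iffD1, OF refl refl, rotated]) (auto simp: eventually_at_filter)
    qed
    moreover have "peval f (a + t *s b + s *s v) = poly P t + s * poly (poly H [:s:]) t" for s
      using Q[of s t] by (simp add: PH algebra_simps)
    ultimately show "((\<lambda>s. peval f (a + t *s b + s *s v)) has_field_derivative poly (poly H 0) t) (at 0)"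
      by simp
  qed
  obtain M where M: "\<And>s t. norm s \<le> 1 \<Longrightarrow> peval f (a + s *s v + t *s b) = 0 \<Longrightarrow> norm t \<le> M"
    using bounded_roots[OF qf b, of a v] by metis
  have "\<forall>\<^sub>F s in at 0. rsquarefree (poly Q [:s:])"
  proof (rule sequentially_imp_eventually_at, intro allI impI, elim conjE)
    fix s :: "nat \<Rightarrow> complex"
    assume s: "\<forall>n. s n \<noteq> 0" "s \<longlonglongrightarrow> 0"
    show "\<forall>\<^sub>F n in sequentially. rsquarefree (poly Q [:s n:])"
    proof (rule ccontr)
      have "\<forall>\<^sub>F n in sequentially. norm (s n) \<le> 1"
        using tendstoD[OF s(2), of 1] by (auto elim: eventually_mono)
      moreover assume "\<not> ?thesis"
      ultimately have "\<not> (\<forall>\<^sub>F n in sequentially. norm (s n) \<le> 1 \<longrightarrow> rsquarefree (poly Q [:s n:]))"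
        using eventually_elim2 by (smt (verit))
      \<comment> \<open>If the claim fails, infinitely many of these lines have a double root t n;
        by the bound M a subsequence of these roots converges.\<close>
      then obtain r :: "nat \<Rightarrow> nat" where r: "strict_mono r"
        "\<And>n. norm (s (r n)) \<le> 1" "\<And>n. \<not> rsquarefree (poly Q [:s (r n):])"
        using not_eventually_sequentiallyD by (metis (no_types, lifting))
      then obtain t where t: "\<And>n. poly (poly Q [:s (r n):]) (t n) = 0"
        "\<And>n. poly (pderiv (poly Q [:s (r n):])) (t n) = 0"
        unfolding rsquarefree_roots by metis
      have "norm (t n) \<le> M" for n using M r(2) t(1) Q by metis
      then have "bounded (range t)" by (auto simp: bounded_iff)
      then obtain t0 r' where r': "strict_mono (r' :: nat \<Rightarrow> nat)" "(t \<circ> r') \<longlonglongrightarrow> t0"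
        using bounded_imp_convergent_subsequence by blast
      have "(\<lambda>n. s (r (r' n))) \<longlonglongrightarrow> 0"
        using LIMSEQ_subseq_LIMSEQ[OF LIMSEQ_subseq_LIMSEQ[OF s(2) r(1)] r'(1)] by (simp add: o_def)
      then show False
        by (rule no_double_roots_near_zero[where t = "t \<circ> r'" and ?t0.0 = t0 and P = P and H = H])
          (use s r' t v H P \<open>P \<noteq> 0\<close> in \<open>auto simp: PH T_def\<close>)
    qed
  qed
  with Q show ?thesis by (rule that)
qed

lemma smooth_quartic_nonzero:
  assumes "quartic_form f"
  obtains b where "peval f b \<noteq> 0"
proof -
  have "f \<noteq> 0" using assms by (simp add: quartic_form_def)
  then show ?thesis using peval_eq_imp_eq[of f 0] that by auto
qed

text \<open>
  Fix \<open>b\<close> off the surface. A line with direction \<open>b\<close> that meets the surface in four distinct points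
  determines the restriction of the transformed form up to the factor read off at infinity, and such
  lines are dense.
\<close>

lemma smooth_quartic_rigid:
  fixes A :: "complex^4^4"
  assumes f: "smooth_quartic f" and zeros: "\<And>x. peval f x = 0 \<Longrightarrow> peval f (A *v x) = 0"
  obtains c where "\<And>x. peval f (A *v x) = c * peval f x"
proof -
  have qf: "quartic_form f" using f by (simp add: smooth_quartic_def)
  obtain b where b: "peval f b \<noteq> 0" using smooth_quartic_nonzero[OF qf] by blast
  define c where "c = peval f (A *v b) / peval f b"
  have "peval f (A *v a) = c * peval f a" for a
  proof (cases "\<exists>t. a + t *s b = 0")
    \<comment> \<open>This line passes through the origin, so it does not represent a projective
      line; but a is then a multiple of b, and homogeneity suffices.\<close>
    case True
    then obtain t where "a + t *s b = 0" by blast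
    then have a: "a = (- t) *s b" by (simp add: vec_eq_iff eq_neg_iff_add_eq_0)
    show ?thesis unfolding a vector_scalar_commute quartic_form_scale[OF qf]
      using b by (simp add: c_def)
  next
    case False
    then obtain v Q where Q: "\<And>s t. poly (poly Q [:s:]) t = peval f (a + s *s v + t *s b)"
      "\<forall>\<^sub>F s in at 0. rsquarefree (poly Q [:s:])"
      using transversal_lines[OF f b] by metis
    have on_line: "peval f (A *v (a + s *s v)) - c * peval f (a + s *s v) = 0"
      if sqf: "rsquarefree (poly Q [:s:])" for s
    proof -
      let ?F = "poly Q [:s:]"
      obtain p where p: "degree p \<le> 4" "coeff p 4 = peval f b"
        "\<And>t. poly p t = peval f (a + s *s v + t *s b)"
        using quartic_form_on_line[OF qf] by metis
      have "p = ?F" by (rule poly_ext) (simp add: p Q)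
      with p b have deg: "degree ?F = 4" using le_degree[of ?F 4] by auto
      then have "?F \<noteq> 0" by auto
      have card: "card {t. poly ?F t = 0} = 4"
      proof -
        have "degree (smult (lead_coeff ?F) (\<Prod>z\<in>{z. poly ?F z = 0}. [:- z, 1:])) = card {t. poly ?F t = 0}"
          using \<open>?F \<noteq> 0\<close> by (subst degree_smult_eq) (simp add: degree_prod_eq_sum_degree)
        then show ?thesis using complex_poly_decompose_rsquarefree[OF sqf] deg by metis
      qed
      obtain q where q: "degree q \<le> 4" "coeff q 4 = peval f (A *v b)"
        "\<And>t. poly q t = peval f (A *v (a + s *s v) + t *s (A *v b))"
        using quartic_form_on_line[OF qf] by metis
      \<comment> \<open>By the choice of c the coefficients of t^4 cancel, so D has degree at most 3
        but vanishes at four points.\<close>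
      define D where "D = q - smult c ?F"
      have "D = 0"
      proof (rule ccontr)
        assume "D \<noteq> 0"
        have "coeff D 4 = 0" using q p b \<open>p = ?F\<close> by (simp add: D_def c_def)
        moreover have "degree D \<le> 4" unfolding D_def
          using q deg by (intro degree_diff_le) (auto intro: order.trans[OF degree_smult_le])
        ultimately have "degree D < 4" using \<open>D \<noteq> 0\<close> leading_coeff_0_iff le_neq_implies_less by metis
        have "{t. poly ?F t = 0} \<subseteq> {t. poly D t = 0}"
        proof safe
          fix t assume t: "poly ?F t = 0"
          then have "peval f (A *v (a + s *s v + t *s b)) = 0" using zeros by (simp add: Q)
          then show "poly D t = 0" using t
            by (simp add: D_def q matrix_vector_right_distrib vector_scalar_commute)
        qed
        then have "4 \<le> card {t. poly D t = 0}"
          using card poly_roots_finite[OF \<open>D \<noteq> 0\<close>] card_mono by metis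
        then show False using card_poly_roots_bound[OF \<open>D \<noteq> 0\<close>] \<open>degree D < 4\<close> by linarith
      qed
      then have "q = smult c ?F" by (simp add: D_def)
      then have "poly q 0 = c * poly ?F 0" by simp
      then show ?thesis by (simp add: q Q)
    qed
    \<comment> \<open>The identity holds on the shifted lines for small nonzero s; continuity
      carries it to s = 0.\<close>
    let ?g = "\<lambda>s. peval f (A *v (a + s *s v)) - c * peval f (a + s *s v)"
    have "isCont ?g 0"
    proof -
      have "isCont (\<lambda>s. peval f (x + s *s y)) 0" for x y
        using peval_deriv DERIV_isCont by blast
      then show ?thesis
        unfolding matrix_vector_right_distrib vector_scalar_commute
        by (intro continuous_intros)
    qed
    then have "?g \<midarrow>0\<rightarrow> ?g 0" by (simp add: isCont_def)
    moreover have "?g \<midarrow>0\<rightarrow> 0"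
      by (rule tendsto_eventually) (use Q(2) on_line in \<open>auto elim: eventually_mono\<close>)
    ultimately have "?g 0 = 0" by (rule tendsto_unique[OF trivial_limit_at])
    then show ?thesis by simp
  qed
  then show ?thesis by (rule that)
qed

section \<open>Invariant surfaces and semi-invariant forms\<close>

lemma mat4_mult_vec:
  "mat4 [a11, a12, a13, a14] [a21, a22, a23, a24] [a31, a32, a33, a34] [a41, a42, a43, a44] *v x =
     vector [a11 * x $ 1 + a12 * x $ 2 + a13 * x $ 3 + a14 * x $ 4,
             a21 * x $ 1 + a22 * x $ 2 + a23 * x $ 3 + a24 * x $ 4,
             a31 * x $ 1 + a32 * x $ 2 + a33 * x $ 3 + a34 * x $ 4,
             a41 * x $ 1 + a42 * x $ 2 + a43 * x $ 3 + a44 * x $ 4]"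
  by (simp add: vec_eq_iff forall_4 matrix_vector_mult_def sum_4 mat4_def)

lemma scale_mat_mult_vec: "scale_mat c A *v x = c *s (A *v x)"
  by (simp add: vec_eq_iff scale_mat_def matrix_vector_mult_def sum_distrib_left mult.assoc)

lemma vector_4_eta: "vector [x $ 1, x $ 2, x $ 3, x $ 4] = (x :: 'a::zero^4)"
  by (simp add: vec_eq_iff forall_4)

lemma invertible_if_trivial_kernel:
  fixes A :: "complex^'n^'n"
  assumes "\<And>x. A *v x = 0 \<Longrightarrow> x = 0"
  shows "invertible A"
  using assms matrix_left_invertible_ker[of A] invertible_left_inverse by blast

lemma mat_mult_vec: "mat c *v x = c *s (x :: complex^'n)"
  by (simp add: vec_eq_iff matrix_vector_mult_def mat_def if_distrib[of "\<lambda>y. y * _"] cong: if_cong)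

lemma mat_mult_mat: "mat c ** mat d = (mat (c * d) :: complex^'n^'n)"
  by (simp add: matrix_eq matrix_vector_mul_assoc[symmetric] mat_mult_vec vec_eq_iff)

lemma mat_mult_commute: "mat c ** A = A ** (mat c :: complex^'n^'n)"
  by (simp add: matrix_eq matrix_vector_mul_assoc[symmetric] mat_mult_vec vector_scalar_commute)

lemma invertible_mat: "c \<noteq> 0 \<Longrightarrow> invertible (mat c :: complex^'n^'n)"
  by (rule invertible_if_trivial_kernel) (simp add: mat_mult_vec vec_eq_iff)

section \<open>The quotient PGL and its action on surfaces\<close>

lemma group_GL: "group (GL :: (complex^'n^'n) monoid)"
proof (rule groupI)
  fix x :: "complex^'n^'n" assume "x \<in> carrier GL"
  then obtain y where "x ** y = mat 1" "y ** x = mat 1" by (auto simp: GL_def invertible_def)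
  then show "\<exists>y\<in>carrier GL. y \<otimes>\<^bsub>GL\<^esub> x = \<one>\<^bsub>GL\<^esub>"
    by (auto simp: GL_def invertible_def)
qed (auto simp: GL_def invertible_mult invertible_mat matrix_mul_assoc)

lemma normal_scalar_matrices: "scalar_matrices \<lhd> (GL :: (complex^'n^'n) monoid)"
proof -
  interpret group "GL :: (complex^'n^'n) monoid" by (rule group_GL)
  have "subgroup scalar_matrices (GL :: (complex^'n^'n) monoid)"
  proof (rule subgroupI)
    fix A :: "complex^'n^'n" assume "A \<in> scalar_matrices"
    then obtain c where c: "A = mat c" "c \<noteq> 0" by (auto simp: scalar_matrices_def)
    have "inv\<^bsub>GL\<^esub> A = mat (inverse c)"
      by (rule inv_equality) (use c in \<open>auto simp: GL_def mat_mult_mat invertible_mat\<close>)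
    then show "inv\<^bsub>GL\<^esub> A \<in> scalar_matrices"
      using c by (auto simp: scalar_matrices_def intro!: exI[of _ "inverse c"])
  next
    fix A B :: "complex^'n^'n" assume "A \<in> scalar_matrices" "B \<in> scalar_matrices"
    then show "A \<otimes>\<^bsub>GL\<^esub> B \<in> scalar_matrices"
      by (auto simp: scalar_matrices_def GL_def mat_mult_mat)
  qed (auto simp: scalar_matrices_def GL_def invertible_mat intro: exI[of _ 1])
  moreover have "h ** x = x ** h" if "h \<in> scalar_matrices" for h x :: "complex^'n^'n"
    using that by (auto simp: scalar_matrices_def intro: mat_mult_commute)
  ultimately show ?thesis
    by (intro normalI) (simp_all add: r_coset_def l_coset_def GL_def)
qed

lemma pgl_class_eq: "pgl_class A = {mat c ** A | c. c \<noteq> 0}"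
  by (auto simp: pgl_class_def r_coset_def scalar_matrices_def GL_def)

lemma mem_pgl_class: "A \<in> pgl_class A"
  unfolding pgl_class_eq by (auto intro!: exI[of _ 1])

lemma proj_map_point: "proj_map A (proj_point x) = proj_point (A *v x)"
  unfolding proj_map_def proj_point_def vector_scalar_commute[symmetric] by blast

lemma mem_proj_point: "x \<in> proj_point x"
  by (auto simp: proj_point_def intro!: exI[of _ 1])

lemma proj_point_in_surface:
  assumes "quartic_form f"
  shows "proj_point x \<in> surface f \<longleftrightarrow> x \<noteq> 0 \<and> peval f x = 0"
proof
  assume "proj_point x \<in> surface f"
  then obtain y where y: "proj_point x = proj_point y" "y \<noteq> 0" "peval f y = 0"
    by (auto simp: surface_def)
  with mem_proj_point[of x] obtain c where "x = c *s y" "c \<noteq> 0" by (auto simp: proj_point_def)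
  with y show "x \<noteq> 0 \<and> peval f x = 0" by (simp add: quartic_form_scale[OF assms])
qed (auto simp: surface_def)

text \<open>The form is only an eigenvector, since matrices represent projective maps up to scalars.
  A nonzero factor lets the property pass to inverses.\<close>

definition semi_invariant :: "quad_poly \<Rightarrow> complex^4^4 \<Rightarrow> bool" where
  "semi_invariant f A \<longleftrightarrow> (\<exists>c. c \<noteq> 0 \<and> (\<forall>x. peval f (A *v x) = c * peval f x))"

lemma peval_at_0: "quartic_form f \<Longrightarrow> peval f 0 = 0"
  using quartic_form_scale[of f 0 0] by simp

lemma semi_invariant_if_surface_invariant:
  assumes f: "smooth_quartic f" and inv: "invariant_under (pgl_generated S) (surface f)"
    and A: "A \<in> S" "invertible A"
  shows "semi_invariant f A"
proof -
  have qf: "quartic_form f" using f by (simp add: smooth_quartic_def)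
  have "pgl_class A \<in> pgl_generated S"
    unfolding pgl_generated_def using A by (auto intro: generate.incl)
  then have image: "proj_map A ` surface f = surface f"
    using inv A unfolding invariant_under_def by blast
  have "peval f (A *v x) = 0" if x: "peval f x = 0" for x
  proof (cases "x = 0")
    case True
    then show ?thesis by (simp add: peval_at_0[OF qf])
  next
    case False
    then have "proj_map A (proj_point x) \<in> surface f"
      using image x proj_point_in_surface[OF qf, of x] by blast
    then show ?thesis by (simp add: proj_map_point proj_point_in_surface[OF qf])
  qed
  then obtain c where c: "\<And>x. peval f (A *v x) = c * peval f x"
    using smooth_quartic_rigid[OF f] by metis
  obtain b where b: "peval f b \<noteq> 0" using smooth_quartic_nonzero[OF qf] by blast
  \<comment> \<open>Since A is onto, the composed form takes the nonzero value of f at b, so the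
    factor is not 0.\<close>
  obtain B where "A ** B = mat 1" using A(2) by (auto simp: invertible_def)
  then have "A *v (B *v b) = b" by (simp add: matrix_vector_mul_assoc)
  then have "c \<noteq> 0" using b c[of "B *v b"] by auto
  with c show ?thesis by (auto simp: semi_invariant_def)
qed

lemma semi_invariant_mult:
  "semi_invariant f A \<Longrightarrow> semi_invariant f B \<Longrightarrow> semi_invariant f (A ** B)"
  unfolding semi_invariant_def matrix_vector_mul_assoc[symmetric]
  by (metis mult.assoc mult_eq_0_iff)

lemma semi_invariant_mat: "quartic_form f \<Longrightarrow> c \<noteq> 0 \<Longrightarrow> semi_invariant f (mat c)"
  unfolding semi_invariant_def mat_mult_vec
  by (intro exI[of _ "c ^ 4"]) (simp add: quartic_form_scale)

lemma semi_invariant_right_inverse: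
  assumes "semi_invariant f A" "A ** B = mat 1"
  shows "semi_invariant f B"
proof -
  obtain c where c: "c \<noteq> 0" "\<And>x. peval f (A *v x) = c * peval f x"
    using assms(1) by (auto simp: semi_invariant_def)
  have "A *v (B *v x) = x" for x using assms(2) by (simp add: matrix_vector_mul_assoc)
  then have "peval f (B *v x) = inverse c * peval f x" for x
    using c(1) c(2)[of "B *v x"] by (simp add: field_simps)
  then show ?thesis using c(1) unfolding semi_invariant_def by (intro exI[of _ "inverse c"]) auto
qed

lemma surface_image:
  assumes qf: "quartic_form f" and A: "invertible A" "semi_invariant f A"
  shows "proj_map A ` surface f = surface f"
proof -
  obtain c where c: "c \<noteq> 0" "\<And>x. peval f (A *v x) = c * peval f x"
    using A(2) by (auto simp: semi_invariant_def)
  obtain B where B: "A ** B = mat 1" "B ** A = mat 1" using A(1) by (auto simp: invertible_def)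
  then have AB: "A *v (B *v x) = x" "B *v (A *v x) = x" for x
    by (simp_all add: matrix_vector_mul_assoc)
  have nz: "A *v x \<noteq> 0 \<longleftrightarrow> x \<noteq> 0" for x using AB(2)[of x] by auto
  have sub: "proj_map A p \<in> surface f" if p: "p \<in> surface f" for p
  proof -
    obtain x where "p = proj_point x" "x \<noteq> 0" "peval f x = 0" using p by (auto simp: surface_def)
    then show ?thesis by (simp add: proj_map_point proj_point_in_surface[OF qf] nz c(2))
  qed
  have "p \<in> proj_map A ` surface f" if p: "p \<in> surface f" for p
  proof -
    obtain x where x: "p = proj_point x" "x \<noteq> 0" "peval f x = 0" using p by (auto simp: surface_def)
    have "p = proj_map A (proj_point (B *v x))" by (simp add: proj_map_point AB x)
    moreover have "proj_point (B *v x) \<in> surface f"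
      using x c AB nz[of "B *v x"] c(2)[of "B *v x"] by (auto simp: proj_point_in_surface[OF qf])
    ultimately show ?thesis by blast
  qed
  with sub show ?thesis by blast
qed

text \<open>\<open>invariant_under\<close> ranges over all matrices representing elements of the
  generated group. The induction therefore carries the property for every representative of a class;
  scalars only contribute fourth powers to the factor.\<close>

lemma surface_invariant_if_semi_invariant:
  assumes qf: "quartic_form f" and S: "\<And>A. A \<in> S \<Longrightarrow> invertible A \<and> semi_invariant f A"
  shows "invariant_under (pgl_generated S) (surface f)"
proof -
  interpret GL: group "GL :: (complex^4^4) monoid" by (rule group_GL)
  interpret N: normal scalar_matrices "GL :: (complex^4^4) monoid" by (rule normal_scalar_matrices)
  have PGL_simps: "X \<otimes>\<^bsub>PGL\<^esub> Y = X <#>\<^bsub>GL\<^esub> Y" "\<one>\<^bsub>PGL\<^esub> = (scalar_matrices :: (complex^4^4) set)"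
    for X Y :: "(complex^4^4) set"
    by (simp_all add: PGL_def FactGroup_def)
  have class_ok: "invertible B \<and> semi_invariant f B"
    if "invertible A" "semi_invariant f A" "B \<in> pgl_class A" for A B
    using that by (auto simp: pgl_class_eq intro!: invertible_mult invertible_mat semi_invariant_mult
        semi_invariant_mat[OF qf])
  have "\<forall>A\<in>X. invertible A \<and> semi_invariant f A" if "X \<in> generate PGL (pgl_class ` S)" for X
    using that
  proof (induction rule: generate.induct)
    case one
    then show ?case
      by (auto simp: PGL_simps scalar_matrices_def invertible_mat semi_invariant_mat[OF qf])
  next
    case (incl X)
    then show ?case using S class_ok by blast
  next
    case (inv X)
    then obtain A where A: "A \<in> S" "X = pgl_class A" by blast
    then have carr: "A \<in> carrier GL" using S by (simp add: GL_def)
    have "inv\<^bsub>PGL\<^esub> X = set_inv\<^bsub>GL\<^esub> X" unfolding PGL_def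
      by (rule N.inv_FactGroup) (use carr in \<open>auto simp: A pgl_class_def FactGroup_def RCOSETS_def\<close>)
    also have "\<dots> = pgl_class (inv\<^bsub>GL\<^esub> A)"
      unfolding A pgl_class_def by (rule N.rcos_inv[OF carr])
    finally have "inv\<^bsub>PGL\<^esub> X = pgl_class (inv\<^bsub>GL\<^esub> A)" .
    moreover have "invertible (inv\<^bsub>GL\<^esub> A)" using GL.inv_closed[OF carr] by (simp add: GL_def)
    moreover have "A ** inv\<^bsub>GL\<^esub> A = mat 1" using GL.r_inv[OF carr] by (simp add: GL_def)
    ultimately show ?case using class_ok semi_invariant_right_inverse S A by metis
  next
    case (eng X Y)
    then show ?case
      by (auto simp: PGL_simps set_mult_def GL_def intro: invertible_mult semi_invariant_mult)
  qed
  then show ?thesis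
    unfolding invariant_under_def pgl_generated_def using mem_pgl_class surface_image[OF qf] by metis
qed

section \<open>Coefficients addressed by four exponents\<close>

definition expo :: "nat \<times> nat \<times> nat \<times> nat \<Rightarrow> (4 \<Rightarrow>\<^sub>0 nat)" where
  "expo = (\<lambda>(a, b, c, d). Poly_Mapping.single 1 a + Poly_Mapping.single 2 b
     + Poly_Mapping.single 3 c + Poly_Mapping.single 4 d)"

lemma lookup_expo [simp]:
  "Poly_Mapping.lookup (expo (a, b, c, d)) 1 = a"
  "Poly_Mapping.lookup (expo (a, b, c, d)) 2 = b"
  "Poly_Mapping.lookup (expo (a, b, c, d)) 3 = c"
  "Poly_Mapping.lookup (expo (a, b, c, d)) 4 = d"
  by (simp_all add: expo_def lookup_add lookup_single)

lemma inj_expo: "inj expo"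
proof (rule injI)
  fix p q assume eq: "expo p = expo q"
  obtain a b c d a' b' c' d' where "p = (a, b, c, d)" "q = (a', b', c', d')"
    by (metis prod_cases4)
  with eq show "p = q" by (metis lookup_expo)
qed

lemma expo_eta:
  "expo (Poly_Mapping.lookup m 1, Poly_Mapping.lookup m 2, Poly_Mapping.lookup m 3, Poly_Mapping.lookup m 4) = m"
proof (rule poly_mapping_eqI)
  fix k :: 4
  show "Poly_Mapping.lookup (expo (Poly_Mapping.lookup m 1, Poly_Mapping.lookup m 2,
      Poly_Mapping.lookup m 3, Poly_Mapping.lookup m 4)) k = Poly_Mapping.lookup m k"
    using exhaust_4[of k] by (elim disjE) simp_all
qed

definition coef :: "quad_poly \<Rightarrow> nat \<Rightarrow> nat \<Rightarrow> nat \<Rightarrow> nat \<Rightarrow> complex" where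
  "coef f a b c d = Poly_Mapping.lookup f (expo (a, b, c, d))"

text \<open>Once symmetries have confined the support to a short list, this makes the form an
  explicit expression open to \<open>algebra\<close>.\<close>

lemma peval_supported:
  assumes "finite L"
    and "\<And>a b c d. coef f a b c d \<noteq> 0 \<Longrightarrow> (a, b, c, d) \<in> L"
  shows "peval f x = (\<Sum>(a, b, c, d)\<in>L. coef f a b c d * (x $ 1 ^ a * x $ 2 ^ b * x $ 3 ^ c * x $ 4 ^ d))"
proof -
  have "Poly_Mapping.keys f \<subseteq> expo ` L"
  proof
    fix m assume "m \<in> Poly_Mapping.keys f"
    then show "m \<in> expo ` L"
      using assms(2) expo_eta[of m] unfolding coef_def in_keys_iff by (metis image_eqI)
  qed
  then show ?thesis
    using assms(1) by (subst peval_superset[of "expo ` L"])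
      (auto simp: sum.reindex inj_on_subset[OF inj_expo] prod_4 coef_def split: prod.splits intro!: sum.cong)
qed

lemma coef_quartic:
  assumes "quartic_form f" "coef f a b c d \<noteq> 0"
  shows "a + b + c + d = 4"
proof -
  have "expo (a, b, c, d) \<in> Poly_Mapping.keys f" using assms(2) by (simp add: coef_def in_keys_iff)
  then have "(\<Sum>i\<in>UNIV. Poly_Mapping.lookup (expo (a, b, c, d)) i) = 4"
    using assms(1) unfolding quartic_form_def by blast
  then show ?thesis by (simp add: sum_4)
qed

text \<open>Monomials are eigenvectors of a diagonal substitution, so those that occur all have the
  eigenvalue k.\<close>

lemma coef_diagonal:
  assumes diag: "\<And>x. peval f (vector [d1 * x $ 1, d2 * x $ 2, d3 * x $ 3, d4 * x $ 4]) = k * peval f x"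
    and nz: "coef f a b c d \<noteq> 0"
  shows "d1 ^ a * d2 ^ b * d3 ^ c * d4 ^ d = k"
proof -
  let ?m = "expo (a, b, c, d)" and ?D = "vector [d1, d2, d3, d4] :: complex^4"
  have "Poly_Mapping.lookup f ?m * (monomial_value ?m ?D - k) = 0"
  proof (rule monomials_independent[where S = "Poly_Mapping.keys f"])
    fix x :: "complex^4"
    have split: "monomial_value m (vector [d1 * x $ 1, d2 * x $ 2, d3 * x $ 3, d4 * x $ 4]) =
        monomial_value m ?D * monomial_value m x" for m
      by (simp add: prod_4 power_mult_distrib mult_ac)
    have "(\<Sum>m\<in>Poly_Mapping.keys f. Poly_Mapping.lookup f m * (monomial_value m ?D - k) * monomial_value m x) =
        peval f (vector [d1 * x $ 1, d2 * x $ 2, d3 * x $ 3, d4 * x $ 4]) - k * peval f x"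
      unfolding peval_def split sum_distrib_left sum_subtractf[symmetric]
      by (intro sum.cong refl) (simp only: left_diff_distrib right_diff_distrib mult_ac)
    then show "(\<Sum>m\<in>Poly_Mapping.keys f. Poly_Mapping.lookup f m * (monomial_value m ?D - k) * monomial_value m x) = 0"
      by (simp only: diag diff_self)
  qed (use nz in \<open>simp_all add: coef_def in_keys_iff\<close>)
  with nz show ?thesis by (simp add: coef_def prod_4)
qed

lemma poly_4_zero:
  fixes a b c d e :: complex
  assumes "\<And>u. a + b * u + c * u ^ 2 + d * u ^ 3 + e * u ^ 4 = 0"
  shows "a = 0" "b = 0" "c = 0" "d = 0" "e = 0"
proof -
  have "poly [:a, b, c, d, e:] u = 0" for u
    using assms[of u] by (simp add: algebra_simps power2_eq_square power3_eq_cube power4_eq_xxxx)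
  then have "[:a, b, c, d, e:] = 0" using poly_all_0_iff_0 by blast
  then show "a = 0" "b = 0" "c = 0" "d = 0" "e = 0" by auto
qed

lemma singular_formI:
  assumes "vector [p1, p2, p3, p4] \<noteq> (0 :: complex^4)"
    and "((\<lambda>s. peval f (vector [p1 + s, p2, p3, p4])) has_field_derivative 0) (at 0)"
    and "((\<lambda>s. peval f (vector [p1, p2 + s, p3, p4])) has_field_derivative 0) (at 0)"
    and "((\<lambda>s. peval f (vector [p1, p2, p3 + s, p4])) has_field_derivative 0) (at 0)"
    and "((\<lambda>s. peval f (vector [p1, p2, p3, p4 + s])) has_field_derivative 0) (at 0)"
  shows "singular_form f"
proof -
  let ?p = "vector [p1, p2, p3, p4] :: complex^4"
  have "vector [p1 + s, p2, p3, p4] = ?p + s *s axis 1 1" "vector [p1, p2 + s, p3, p4] = ?p + s *s axis 2 1"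
    "vector [p1, p2, p3 + s, p4] = ?p + s *s axis 3 1" "vector [p1, p2, p3, p4 + s] = ?p + s *s axis 4 1" for s
    by (simp_all add: vec_eq_iff forall_4 axis_def)
  then have "((\<lambda>s. peval f (?p + s *s axis i 1)) has_field_derivative 0) (at 0)" for i
    using assms(2-) exhaust_4[of i] by auto
  then have "(\<Sum>j\<in>UNIV. axis i 1 $ j * peval (pderiv_wrt j f) ?p) = 0" for i
    using DERIV_unique[OF peval_deriv] by blast
  moreover have "(\<Sum>j\<in>UNIV. axis i 1 $ j * peval (pderiv_wrt j f) ?p) = peval (pderiv_wrt i f) ?p" for i
    by (simp add: axis_def if_distrib[of "\<lambda>y. y * _"] cong: if_cong)
  ultimately show ?thesis using assms(1) unfolding singular_form_def by metis
qed

section \<open>The groups without smooth invariant quartics\<close>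

lemma peval_pderiv_wrt_eqI:
  assumes "((\<lambda>s. peval f (x + s *s axis i 1)) has_field_derivative D) (at 0)"
  shows "peval (pderiv_wrt i f) x = D"
proof -
  have "(\<Sum>j\<in>UNIV. axis i 1 $ j * peval (pderiv_wrt j f) x) = D"
    by (rule DERIV_unique[OF peval_deriv assms])
  then show ?thesis by (simp add: axis_def if_distrib[of "\<lambda>y. y * _"] cong: if_cong)
qed

text \<open>The chain rule. At a fixed point p of A it says that the gradient is an eigenvector of
  the transpose of A.\<close>

lemma gradient_semi_invariant:
  assumes "\<And>x. peval f (A *v x) = k * peval f x"
  shows "(\<Sum>i\<in>UNIV. (A *v v) $ i * peval (pderiv_wrt i f) (A *v p)) =
    k * (\<Sum>i\<in>UNIV. v $ i * peval (pderiv_wrt i f) p)"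
proof (rule DERIV_unique)
  show "((\<lambda>s. peval f (A *v p + s *s (A *v v))) has_field_derivative
      (\<Sum>i\<in>UNIV. (A *v v) $ i * peval (pderiv_wrt i f) (A *v p))) (at 0)"
    by (rule peval_deriv)
  have "A *v p + s *s (A *v v) = A *v (p + s *s v)" for s
    by (simp only: matrix_vector_right_distrib vector_scalar_commute)
  then have "(\<lambda>s. peval f (A *v p + s *s (A *v v))) = (\<lambda>s. k * peval f (p + s *s v))"
    using assms by simp
  then show "((\<lambda>s. peval f (A *v p + s *s (A *v v))) has_field_derivative
      k * (\<Sum>i\<in>UNIV. v $ i * peval (pderiv_wrt i f) p)) (at 0)"
    using DERIV_cmult[OF peval_deriv, of k f p v] by simp
qed

lemma primitive_cube_root:
  assumes "primitive_root_of_unity 3 \<omega>"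
  shows "\<omega> ^ 3 = 1" "\<omega> \<noteq> 1" "\<omega> ^ 2 \<noteq> 1" "\<omega> ^ 2 \<noteq> \<omega>" "\<omega> \<noteq> 0"
proof -
  show w: "\<omega> ^ 3 = 1" using assms by (simp add: primitive_root_of_unity_def)
  have "\<omega> ^ 1 \<noteq> 1" using assms unfolding primitive_root_of_unity_def by (metis less_numeral_extra(1) one_less_numeral_iff semiring_norm(77))
  then show w1: "\<omega> \<noteq> 1" by simp
  show w0: "\<omega> \<noteq> 0" using w by auto
  show "\<omega> ^ 2 \<noteq> 1" using w w1 by (auto simp: power3_eq_cube power2_eq_square)
  show "\<omega> ^ 2 \<noteq> \<omega>" using w0 w1 by (auto simp: power2_eq_square)
qed

lemma primitive_root_power:
  assumes "primitive_root_of_unity n z" "z ^ k = 1"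
  shows "k mod n = 0"
proof -
  have n: "n > 0" "z ^ n = 1" using assms(1) by (auto simp: primitive_root_of_unity_def)
  have "z ^ k = z ^ (n * (k div n) + k mod n)" by simp
  also have "\<dots> = (z ^ n) ^ (k div n) * z ^ (k mod n)" by (simp only: power_add power_mult)
  also have "\<dots> = z ^ (k mod n)" unfolding n(2) by simp
  finally have "z ^ (k mod n) = 1" unfolding assms(2) by (rule sym)
  moreover have "k mod n < n" using n(1) by simp
  ultimately show ?thesis using assms(1) unfolding primitive_root_of_unity_def by (metis gr0I)
qed

text \<open>
  The first and third symmetries leave only monomials of bidegree \<open>(2, 2)\<close>; the second one then
  forces the square of the quadric \<open>x\<^sub>1 x\<^sub>3 - x\<^sub>2 x\<^sub>4\<close>.
\<close>

lemma singular_Q4_Q5: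
  assumes qf: "quartic_form f" and \<omega>: "primitive_root_of_unity 3 \<omega>"
    and D: "\<And>x. peval f (vector [\<omega> * x $ 1, \<omega> * x $ 2, \<omega> ^ 2 * x $ 3, \<omega> ^ 2 * x $ 4]) = k * peval f x" "k \<noteq> 0"
    and M: "\<And>x. peval f (vector [x $ 1 + r * x $ 4, x $ 2 + r * x $ 3, r * x $ 2 - x $ 3, r * x $ 1 - x $ 4]) = l * peval f x"
    and r: "r ^ 2 = 2"
    and N: "\<And>x. peval f (vector [\<alpha> * x $ 4, \<beta> * x $ 3, \<gamma> * x $ 2, \<delta> * x $ 1]) = m * peval f x" "m \<noteq> 0"
  shows "singular_form f"
proof -
  note w = primitive_cube_root[OF \<omega>]
  obtain b where b: "peval f b \<noteq> 0" using smooth_quartic_nonzero[OF qf] by blast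
  let ?D = "\<lambda>x. vector [\<omega> * x $ 1, \<omega> * x $ 2, \<omega> ^ 2 * x $ 3, \<omega> ^ 2 * x $ 4] :: complex^4"
  let ?N = "\<lambda>x. vector [\<alpha> * x $ 4, \<beta> * x $ 3, \<gamma> * x $ 2, \<delta> * x $ 1] :: complex^4"
  \<comment> \<open>\<open>?N\<close> interchanges the two eigenspaces of \<open>?D\<close> and
    \<omega>^4 = \<omega>, so it conjugates \<open>?D\<close> to its square. Comparing factors gives
    m k = k^2 m.\<close>
  have "\<omega> * (\<omega> * \<omega>) = 1" using w(1) by (simp add: power3_eq_cube mult.assoc)
  then have "?N (?D b) = ?D (?D (?N b))"
    by (simp add: vec_eq_iff forall_4 power2_eq_square mult_ac)
  then have "m * (k * peval f b) = k * (k * (m * peval f b))" by (metis D(1) N(1))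
  then have k: "k = 1" using b D(2) N(2) by simp
  have ab: "a + b = 2 \<and> c + d = 2" if nz: "coef f a b c d \<noteq> 0" for a b c d
  proof -
    have sum: "a + b + c + d = 4" by (rule coef_quartic[OF qf nz])
    have "\<omega> ^ a * \<omega> ^ b * (\<omega> ^ 2) ^ c * (\<omega> ^ 2) ^ d = 1"
      using coef_diagonal[OF D(1) nz] k by simp
    then have "\<omega> ^ (a + b + 2 * (c + d)) = 1" by (simp add: power_add power_mult distrib_left mult.assoc)
    then have "(a + b + 2 * (c + d)) mod 3 = 0" by (rule primitive_root_power[OF \<omega>])
    \<comment> \<open>The exponent equals 8 - (a + b), and among 4, ..., 8 only 6 is divisible by
      3.\<close>
    with sum show ?thesis by presburger
  qed
  let ?L = "{(2,0,2,0), (2,0,1,1), (2,0,0,2), (1,1,2,0), (1,1,1,1), (1,1,0,2), (0,2,2,0), (0,2,1,1), (0,2,0,2)} :: (nat \<times> nat \<times> nat \<times> nat) set"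
  have L: "(a, b, c, d) \<in> ?L" if "coef f a b c d \<noteq> 0" for a b c d
  proof -
    have "a = 0 \<and> b = 2 \<or> a = 1 \<and> b = 1 \<or> a = 2 \<and> b = 0" "c = 0 \<and> d = 2 \<or> c = 1 \<and> d = 1 \<or> c = 2 \<and> d = 0"
      using ab[OF that] by auto
    then show ?thesis by auto
  qed
  define k1 k2 k3 k4 k5 k6 k7 k8 k9 where ks: "k1 = coef f 2 0 2 0" "k2 = coef f 2 0 1 1" "k3 = coef f 2 0 0 2"
    "k4 = coef f 1 1 2 0" "k5 = coef f 1 1 1 1" "k6 = coef f 1 1 0 2"
    "k7 = coef f 0 2 2 0" "k8 = coef f 0 2 1 1" "k9 = coef f 0 2 0 2"
  have F: "peval f (vector [x, y, z, w]) = k1 * (x ^ 2 * z ^ 2) + k2 * (x ^ 2 * z * w) + k3 * (x ^ 2 * w ^ 2)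
      + k4 * (x * y * z ^ 2) + k5 * (x * y * z * w) + k6 * (x * y * w ^ 2)
      + k7 * (y ^ 2 * z ^ 2) + k8 * (y ^ 2 * z * w) + k9 * (y ^ 2 * w ^ 2)" for x y z w
    by (subst peval_supported[OF _ L]) (simp_all add: ks)
  \<comment> \<open>The form vanishes on the line x_3 = x_4 = 0, hence also on its image, the points
    (1, t, r t, r).\<close>
  have "k3 + (k2 + k6) * t + (k1 + k5 + k9) * t ^ 2 + (k4 + k8) * t ^ 3 + k7 * t ^ 4 = 0" for t
    using M[of "vector [1, t, 0, 0]"] r by (simp add: F) algebra
  from poly_4_zero[OF this]
  have e: "k3 = 0" "k6 = - k2" "k9 = - k1 - k5" "k8 = - k4" "k7 = 0" by (auto simp: eq_neg_iff_add_eq_0 algebra_simps)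
  \<comment> \<open>At (1, t, u, 0) the form has no term linear in u; neither may its transform, and
    that coefficient is the relation wanted.\<close>
  have "k2 + (2 * k1 + k5) * t + k4 * t ^ 2 + 0 * t ^ 3 + 0 * t ^ 4 = 0" for t
  proof -
    have "0 + (- 3 * r * (k2 + (2 * k1 + k5) * t + k4 * t ^ 2)) * u
        + (k1 - 3 * t * k4 - 2 * k5 - 4 * (k1 + k5) - l * (k1 + k4 * t)) * u ^ 2 + 3 * r * k4 * u ^ 3 + 0 * u ^ 4 = 0" for u
      using M[of "vector [1, t, u, 0]"] r by (simp add: F e) algebra
    from poly_4_zero(2)[OF this] show ?thesis using r by auto
  qed
  from poly_4_zero[OF this] e have e': "k2 = 0" "k5 = - 2 * k1" "k4 = 0"
    by (auto simp: eq_neg_iff_add_eq_0 algebra_simps)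
  then have "k9 = k1" using e by simp
  show ?thesis
    by (rule singular_formI[of 1 0 0 0])
      (auto simp: F e e' \<open>k9 = k1\<close> vec_eq_iff forall_4 intro!: derivative_eq_intros)
qed

text \<open>Euler's relation at this point: the first partial derivative is 4 times the
  value.\<close>

lemma pderiv_first_axis:
  assumes qf: "quartic_form f" and zero: "peval f (vector [1, 0, 0, 0]) = 0"
  shows "peval (pderiv_wrt 1 f) (vector [1, 0, 0, 0]) = 0"
proof (rule peval_pderiv_wrt_eqI)
  let ?e = "vector [1, 0, 0, 0] :: complex^4"
  have "?e + s *s axis 1 1 = (1 + s) *s ?e" for s
    by (simp add: vec_eq_iff forall_4 axis_def)
  then show "((\<lambda>s. peval f (?e + s *s axis 1 1)) has_field_derivative 0) (at 0)"
    using zero by (simp add: quartic_form_scale[OF qf] del: vector_sadd_rdistrib)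
qed

lemma singular_at_first_axis:
  assumes "\<And>i. peval (pderiv_wrt i f) (vector [1, 0, 0, 0]) = 0"
  shows "singular_form f"
  unfolding singular_form_def using assms
  by (intro exI[of _ "vector [1, 0, 0, 0]"]) (simp add: vec_eq_iff forall_4)

text \<open>
  If \<open>x\<^sub>1 ^ 4\<close> does not occur, the gradient at \<open>(1, 0, 0, 0)\<close> is a semi-invariant linear form, hence 0.
  Otherwise all multipliers are 1; the restriction to \<open>x\<^sub>1 = 0\<close> is then a multiple of the square of
  \<open>x\<^sub>2\<^sup>2 + 2 x\<^sub>3 x\<^sub>4\<close>, and the surface is singular at the point \<open>(0, 0, 1, 0)\<close> of this conic.
\<close>

lemma singular_Q1:
  fixes A B C :: "complex^4^4"
  assumes qf: "quartic_form f" and \<omega>: "primitive_root_of_unity 3 \<omega>"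
    and A: "\<And>x. A *v x = vector [x $ 1, x $ 2, \<omega> * x $ 3, \<omega> ^ 2 * x $ 4]"
    and B: "\<And>x. B *v x = vector [x $ 1, (- x $ 2 + 2 * x $ 3 + 2 * x $ 4) / 3,
      (2 * x $ 2 - x $ 3 + 2 * x $ 4) / 3, (2 * x $ 2 + 2 * x $ 3 - x $ 4) / 3]"
    and C: "\<And>x. C *v x = vector [x $ 1, - x $ 2, \<kappa> * x $ 4, \<mu> * x $ 3]" "\<kappa> * \<mu> = 1" "\<mu> ^ 3 \<noteq> - 1"
    and semi: "semi_invariant f A" "semi_invariant f B" "semi_invariant f C"
  shows "singular_form f"
proof -
  note w = primitive_cube_root[OF \<omega>]
  obtain a b c where abc: "\<And>x. peval f (A *v x) = a * peval f x" "\<And>x. peval f (B *v x) = b * peval f x"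
    "\<And>x. peval f (C *v x) = c * peval f x"
    using semi unfolding semi_invariant_def by metis
  let ?e = "vector [1, 0, 0, 0] :: complex^4"
  have fixed: "A *v ?e = ?e" "B *v ?e = ?e" "C *v ?e = ?e" by (simp_all add: A B C)
  show ?thesis
  proof (cases "peval f ?e = 0")
    case True
    define g where "g i = peval (pderiv_wrt i f) ?e" for i
    have "g 1 = 0" unfolding g_def by (rule pderiv_first_axis[OF qf True])
    moreover have gA: "g 2 = a * g 2" "\<omega> * g 3 = a * g 3" "\<omega> ^ 2 * g 4 = a * g 4"
      using gradient_semi_invariant[OF abc(1), of "axis 2 1" ?e] gradient_semi_invariant[OF abc(1), of "axis 3 1" ?e]
        gradient_semi_invariant[OF abc(1), of "axis 4 1" ?e]
      unfolding fixed g_def[symmetric] by (simp_all add: A sum_4 axis_def)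
    \<comment> \<open>A has distinct eigenvalues on the last three coordinates, so at most one of g
      2, g 3, g 4 is nonzero; B mixes them and rules this out as well.\<close>
    moreover have gB: "(- g 2 + 2 * g 3 + 2 * g 4) / 3 = b * g 2" "(2 * g 2 - g 3 + 2 * g 4) / 3 = b * g 3"
      using gradient_semi_invariant[OF abc(2), of "axis 2 1" ?e] gradient_semi_invariant[OF abc(2), of "axis 3 1" ?e]
      unfolding fixed g_def[symmetric] by (simp_all add: B sum_4 axis_def add_divide_distrib diff_divide_distrib)
    ultimately have "g 1 = 0 \<and> g 2 = 0 \<and> g 3 = 0 \<and> g 4 = 0"
      using w by auto
    then have "g i = 0" for i using exhaust_4[of i] by auto
    then show ?thesis unfolding g_def by (rule singular_at_first_axis)
  next
    case False
    then have one: "a = 1" "b = 1" "c = 1" using abc[of ?e] fixed by auto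
    let ?L = "{(4,0,0,0), (3,1,0,0), (2,2,0,0), (1,3,0,0), (0,4,0,0), (2,0,1,1), (1,1,1,1), (0,2,1,1), (0,0,2,2),
      (1,0,3,0), (0,1,3,0), (1,0,0,3), (0,1,0,3)} :: (nat \<times> nat \<times> nat \<times> nat) set"
    have L: "(a', b', c', d') \<in> ?L" if nz: "coef f a' b' c' d' \<noteq> 0" for a' b' c' d'
    proof -
      have sum: "a' + b' + c' + d' = 4" by (rule coef_quartic[OF qf nz])
      have "1 ^ a' * 1 ^ b' * \<omega> ^ c' * (\<omega> ^ 2) ^ d' = 1"
        by (rule coef_diagonal[OF _ nz]) (use abc(1) one in \<open>simp add: A\<close>)
      then have "\<omega> ^ (c' + 2 * d') = 1" by (simp add: power_add power_mult)
      then have m: "(c' + 2 * d') mod 3 = 0" by (rule primitive_root_power[OF \<omega>])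
      \<comment> \<open>Modulo 3 the weight c' + 2 d' is c' - d'.\<close>
      have "c' = 0 \<and> d' = 0 \<or> c' = 1 \<and> d' = 1 \<or> c' = 2 \<and> d' = 2 \<or> c' = 3 \<and> d' = 0 \<or> c' = 0 \<and> d' = 3"
        using m sum by presburger
      moreover have "b' = 0 \<or> b' = 1 \<or> b' = 2 \<or> b' = 3 \<or> b' = 4"
        "a' = 4 - b' - c' - d'" "b' + c' + d' \<le> 4" using sum by auto
      ultimately show ?thesis by (elim disjE conjE) simp_all
    qed
    define k1 k2 k3 k4 k5 m1 m2 m3 q g h g' h' where ks: "k1 = coef f 4 0 0 0" "k2 = coef f 3 1 0 0"
      "k3 = coef f 2 2 0 0" "k4 = coef f 1 3 0 0" "k5 = coef f 0 4 0 0" "m1 = coef f 2 0 1 1"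
      "m2 = coef f 1 1 1 1" "m3 = coef f 0 2 1 1" "q = coef f 0 0 2 2"
      "g = coef f 1 0 3 0" "h = coef f 0 1 3 0" "g' = coef f 1 0 0 3" "h' = coef f 0 1 0 3"
    have F: "peval f (vector [x, y, z, w]) = k1 * x ^ 4 + k2 * (x ^ 3 * y) + k3 * (x ^ 2 * y ^ 2) + k4 * (x * y ^ 3)
        + k5 * y ^ 4 + m1 * (x ^ 2 * z * w) + m2 * (x * y * z * w) + m3 * (y ^ 2 * z * w) + q * (z ^ 2 * w ^ 2)
        + g * (x * z ^ 3) + h * (y * z ^ 3) + g' * (x * w ^ 3) + h' * (y * w ^ 3)" for x y z w
      by (subst peval_supported[OF _ L]) (simp_all add: ks)
    have C1: "peval f (vector [x, y, z, w]) = peval f (vector [x, - y, \<kappa> * w, \<mu> * z])" for x y z w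
      using abc(3)[of "vector [x, y, z, w]"] by (simp add: C one)
    have B1: "peval f (vector [x, (- y + 2 * z + 2 * w) / 3, (2 * y - z + 2 * w) / 3, (2 * y + 2 * z - w) / 3])
        = peval f (vector [x, y, z, w])" for x y z w
      using abc(2)[of "vector [x, y, z, w]"] by (simp add: B one)
    have "k2 + k4 = 0" "8 * k2 + 2 * k4 = 0" using C1[of 1 1 0 0] C1[of 2 1 0 0] by (simp_all add: F) algebra+
    then have k24: "k2 = 0" "k4 = 0" by algebra+
    have g: "g = g' * \<mu> ^ 3" using C1[of 1 0 1 0] by (simp add: F power_mult_distrib)
    have h: "h = - (h' * \<mu> ^ 3)" using C1[of 0 1 1 0] by (simp add: F power_mult_distrib)
    have m2: "m2 = 0" using C1[of 1 1 1 1] C(2) g h by (simp add: F k24) algebra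
    \<comment> \<open>Subtracting the values at x = 1 and x = -1 isolates the terms odd in x; by now
      these are only the ones with g and g'.\<close>
    have "g + g' = 0" using B1[of 1 1 0 0] B1[of "-1" 1 0 0] by (simp add: F k24 m2 power_divide) algebra
    then have "g' * (\<mu> ^ 3 + 1) = 0" using g by algebra
    then have g0: "g = 0" "g' = 0" using C(3) g by (auto simp: eq_neg_iff_add_eq_0)
    \<comment> \<open>Both points lie on the surface, and their images differ by exchanging the last
      two coordinates; of the terms left at x = 0, only those with h and h' notice this.\<close>
    have "h = h'" using B1[of 0 0 1 0] B1[of 0 0 0 1] by (simp add: F k24 m2 power_divide) algebra
    moreover have "h' * (\<mu> ^ 3 + 1) = h' - h" using h by (simp add: algebra_simps)
    ultimately have "h' * (\<mu> ^ 3 + 1) = 0" by simp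
    then have h0: "h = 0" "h' = 0" using C(3) h by (auto simp: eq_neg_iff_add_eq_0)
    \<comment> \<open>Every remaining monomial has degree at least 2 in x, y and w, so it vanishes
      to second order at (0, 0, 1, 0).\<close>
    show ?thesis
      by (rule singular_formI[of 0 0 1 0])
        (auto simp: F g0 h0 vec_eq_iff forall_4 intro!: derivative_eq_intros)
  qed
qed

section \<open>The pencil and Klein's group\<close>

lemma pvar_power: "pvar i ^ n = Poly_Mapping.single (Poly_Mapping.single i n) 1"
proof (induction n)
  case (Suc n)
  then show ?case by (simp add: pvar_def mult_single flip: single_add)
qed (simp add: single_zero)

lemma pencil_expand:
  "pencil l = Poly_Mapping.single (expo (4, 0, 0, 0)) (l $ 1) + Poly_Mapping.single (expo (0, 3, 1, 0)) (l $ 2)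
     + Poly_Mapping.single (expo (0, 1, 0, 3)) (l $ 2) + Poly_Mapping.single (expo (0, 0, 3, 1)) (l $ 2)"
proof -
  have "pvar 1 ^ 4 = Poly_Mapping.single (expo (4, 0, 0, 0)) 1"
    "pvar 3 * pvar 2 ^ 3 = Poly_Mapping.single (expo (0, 3, 1, 0)) 1"
    "pvar 4 ^ 3 * pvar 2 = Poly_Mapping.single (expo (0, 1, 0, 3)) 1"
    "pvar 3 ^ 3 * pvar 4 = Poly_Mapping.single (expo (0, 0, 3, 1)) 1"
    unfolding pvar_power unfolding pvar_def mult_single expo_def by (simp_all add: add.commute)
  then show ?thesis
    unfolding pencil_def Let_def pconst_def by (simp add: distrib_left mult_single add.assoc)
qed

lemma peval_pencil:
  "peval (pencil l) (vector [x, y, z, w]) = l $ 1 * x ^ 4 + l $ 2 * (z * y ^ 3 + w ^ 3 * y + z ^ 3 * w)"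
  by (simp add: pencil_expand prod_4 algebra_simps)

lemma quartic_form_pencil:
  assumes "l \<noteq> 0"
  shows "quartic_form (pencil l)"
proof -
  have "Poly_Mapping.keys (pencil l) \<subseteq> expo ` {(4, 0, 0, 0), (0, 3, 1, 0), (0, 1, 0, 3), (0, 0, 3, 1)}"
    unfolding pencil_expand by (intro order.trans[OF keys_add] Un_least) auto
  then have "\<forall>m\<in>Poly_Mapping.keys (pencil l). (\<Sum>i\<in>UNIV. Poly_Mapping.lookup m i) = 4"
    by (auto simp: sum_4)
  moreover have "pencil l \<noteq> 0"
  proof
    assume "pencil l = 0"
    then have "l $ 1 * x ^ 4 + l $ 2 * (z * y ^ 3 + w ^ 3 * y + z ^ 3 * w) = 0" for x y z w
      using peval_pencil[of l x y z w] by simp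
    from this[of 1 0 0 0] this[of 0 1 1 0] have "l $ 1 = 0" "l $ 2 = 0" by simp_all
    with assms show False by (simp add: vec_eq_iff forall_2)
  qed
  ultimately show ?thesis by (simp add: quartic_form_def)
qed

section \<open>Seventh roots of unity and Klein's involution\<close>

lemma zeta7_root: "zeta7 ^ 7 = 1" "zeta7 \<noteq> 1"
proof -
  have "zeta7 ^ 7 = exp (of_nat 7 * (2 * of_real pi * \<i> / 7))"
    by (simp only: zeta7_def exp_of_nat_mult)
  also have "of_nat 7 * (2 * of_real pi * \<i> / 7) = 2 * of_real pi * \<i>" by simp
  finally show "zeta7 ^ 7 = 1" by (simp only: exp_two_pi_i)
  have "sin (2 * pi / 7) > 0" by (rule sin_gt_zero) auto
  then show "zeta7 \<noteq> 1"
    unfolding zeta7_def by (auto simp: complex_eq_iff Im_exp)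
qed

lemma primitive_zeta7: "primitive_root_of_unity 7 zeta7"
proof -
  have "zeta7 ^ k \<noteq> 1" if "0 < k" "k < 7" for k
  proof
    assume k: "zeta7 ^ k = 1"
    have "zeta7 = 1" if "zeta7 ^ 2 = 1" using that zeta7_root(1) by algebra
    moreover have "zeta7 = 1" if "zeta7 ^ 3 = 1" using that zeta7_root(1) by algebra
    moreover have "zeta7 = 1" if "zeta7 ^ 4 = 1" using that zeta7_root(1) by algebra
    moreover have "zeta7 = 1" if "zeta7 ^ 5 = 1" using that zeta7_root(1) by algebra
    moreover have "zeta7 = 1" if "zeta7 ^ 6 = 1" using that zeta7_root(1) by algebra
    moreover have "k = 1 \<or> k = 2 \<or> k = 3 \<or> k = 4 \<or> k = 5 \<or> k = 6" using that by auto
    ultimately show False using k zeta7_root(2) by auto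
  qed
  then show ?thesis using zeta7_root by (simp add: primitive_root_of_unity_def)
qed

text \<open>With \<open>c = z + z ^ 6\<close>, all three numbers are multiples of \<open>u\<close> by polynomials in \<open>c\<close>.\<close>

lemma minus_numbers:
  obtains c where "s_minus = u_minus * c" "t_minus = u_minus * (1 - c ^ 2)" "u_minus ^ 2 = c ^ 2 - 4"
    "c ^ 3 + c ^ 2 - 2 * c - 1 = 0"
proof
  note z7 = zeta7_root(1)
  have "(zeta7 - 1) * (zeta7 ^ 6 + zeta7 ^ 5 + zeta7 ^ 4 + zeta7 ^ 3 + zeta7 ^ 2 + zeta7 + 1) = 0"
    using z7 by algebra
  then have Phi: "zeta7 ^ 6 + zeta7 ^ 5 + zeta7 ^ 4 + zeta7 ^ 3 + zeta7 ^ 2 + zeta7 + 1 = 0"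
    using zeta7_root(2) by simp
  \<comment> \<open>This is 2 cos(2 pi / 7), a root of the cubic below.\<close>
  let ?c = "zeta7 + zeta7 ^ 6"
  show "s_minus = u_minus * ?c"
    unfolding s_minus_def u_minus_def using z7 by algebra
  show "t_minus = u_minus * (1 - ?c ^ 2)"
    unfolding t_minus_def u_minus_def using z7 by algebra
  show "u_minus ^ 2 = ?c ^ 2 - 4"
    unfolding u_minus_def using z7 by algebra
  show "?c ^ 3 + ?c ^ 2 - 2 * ?c - 1 = 0"
    using z7 Phi by algebra
qed

definition klein_map :: "complex^4 \<Rightarrow> complex^4" where
  "klein_map x = vector [x $ 1,
     \<i> / rsqrt 7 * (u_minus * x $ 2 + s_minus * x $ 3 + t_minus * x $ 4),
     \<i> / rsqrt 7 * (s_minus * x $ 2 + t_minus * x $ 3 + u_minus * x $ 4),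
     \<i> / rsqrt 7 * (t_minus * x $ 2 + u_minus * x $ 3 + s_minus * x $ 4)]"

lemma rsqrt7: "(\<i> / rsqrt 7) ^ 2 = - (1 / 7)"
proof -
  have "rsqrt 7 ^ 2 = 7" unfolding rsqrt_def by (simp flip: of_real_power)
  then show ?thesis by (simp add: power_divide)
qed

text \<open>The 3 by 3 block is symmetric, and its rows have square sum -7 and pairwise products 0,
  which the squared scalar -1/7 normalises. This also supplies invertibility.\<close>

lemma klein_map_involution: "klein_map (klein_map x) = x"
proof -
  obtain c where c: "s_minus = u_minus * c" "t_minus = u_minus * (1 - c ^ 2)" "u_minus ^ 2 = c ^ 2 - 4"
    "c ^ 3 + c ^ 2 - 2 * c - 1 = 0" by (rule minus_numbers)
  have sq: "u_minus ^ 2 + s_minus ^ 2 + t_minus ^ 2 = - 7" unfolding c(1,2) using c(3,4) by algebra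
  have mixed: "u_minus * s_minus + s_minus * t_minus + t_minus * u_minus = 0"
    unfolding c(1,2) using c(3,4) by algebra
  have rho: "7 * (\<i> / rsqrt 7) ^ 2 = - 1" using rsqrt7 by simp
  show ?thesis
    unfolding klein_map_def vec_eq_iff forall_4 vector_4_nth
    using sq mixed rho by (intro conjI) algebra+
qed

text \<open>With u factored out, the block has entries polynomial in c, so invariance is an identity
  modulo the cubic of c. The constants reflect (i u / sqrt 7)^4 = (c^2 - 4)^2 / 49.\<close>

lemma klein_quartic_invariant:
  fixes c x y z :: complex
  assumes "c ^ 3 + c ^ 2 - 2 * c - 1 = 0"
    and "X = x + c * y + (1 - c ^ 2) * z" "Y = c * x + (1 - c ^ 2) * y + z" "Z = (1 - c ^ 2) * x + y + c * z"
  shows "(c ^ 2 - 4) ^ 2 * (Y * X ^ 3 + Z ^ 3 * X + Y ^ 3 * Z) = 49 * (y * x ^ 3 + z ^ 3 * x + y ^ 3 * z)"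
  using assms(1) unfolding assms(2-) by algebra


lemma peval_pencil_klein_map: "peval (pencil l) (klein_map x) = peval (pencil l) x"
proof -
  obtain c where c: "s_minus = u_minus * c" "t_minus = u_minus * (1 - c ^ 2)" "u_minus ^ 2 = c ^ 2 - 4"
    "c ^ 3 + c ^ 2 - 2 * c - 1 = 0" by (rule minus_numbers)
  define r where "r = \<i> / rsqrt 7 * u_minus"
  define X Y Z where XYZ: "X = x $ 2 + c * x $ 3 + (1 - c ^ 2) * x $ 4"
    "Y = c * x $ 2 + (1 - c ^ 2) * x $ 3 + x $ 4" "Z = (1 - c ^ 2) * x $ 2 + x $ 3 + c * x $ 4"
  have "r ^ 4 = (((\<i> / rsqrt 7) ^ 2) * u_minus ^ 2) ^ 2"
    unfolding r_def power_mult_distrib power_mult[symmetric] by simp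
  then have r4: "49 * r ^ 4 = (c ^ 2 - 4) ^ 2" unfolding rsqrt7 c(3) by (simp add: power2_eq_square mult.commute)
  have "klein_map x = vector [x $ 1, r * X, r * Y, r * Z]"
    unfolding klein_map_def c(1,2) r_def XYZ by (simp add: vec_eq_iff forall_4 algebra_simps)
  moreover have "(r * Y) * (r * X) ^ 3 + (r * Z) ^ 3 * (r * X) + (r * Y) ^ 3 * (r * Z)
      = x $ 3 * x $ 2 ^ 3 + x $ 4 ^ 3 * x $ 2 + x $ 3 ^ 3 * x $ 4"
  proof -
    have "49 * ((r * Y) * (r * X) ^ 3 + (r * Z) ^ 3 * (r * X) + (r * Y) ^ 3 * (r * Z))
      = (49 * r ^ 4) * (Y * X ^ 3 + Z ^ 3 * X + Y ^ 3 * Z)"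
      by (simp add: power_mult_distrib algebra_simps power3_eq_cube power4_eq_xxxx)
    also have "\<dots> = 49 * (x $ 3 * x $ 2 ^ 3 + x $ 4 ^ 3 * x $ 2 + x $ 3 ^ 3 * x $ 4)"
      unfolding r4 by (rule klein_quartic_invariant[OF c(4) XYZ])
    finally show ?thesis by (simp only: mult_cancel_left) simp
  qed
  ultimately have "peval (pencil l) (klein_map x) = peval (pencil l) (vector [x $ 1, x $ 2, x $ 3, x $ 4])"
    by (simp only: peval_pencil)
  then show ?thesis by (simp only: vector_4_eta)
qed

text \<open>The fixed point (1, 0, 0, 0) makes all factors 1. Then T equates the three coefficients
  of Klein's quartic, and R removes the product of all coordinates.\<close>

lemma pencil_if_semi_invariant:
  fixes S T R :: "complex^4^4"
  assumes qf: "quartic_form f" and smooth: "\<not> singular_form f"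
    and S: "\<And>x. S *v x = vector [x $ 1, zeta7 ^ 4 * x $ 2, zeta7 ^ 2 * x $ 3, zeta7 * x $ 4]"
    and T: "\<And>x. T *v x = vector [x $ 1, x $ 3, x $ 4, x $ 2]"
    and R: "\<And>x. R *v x = klein_map x"
    and semi: "semi_invariant f S" "semi_invariant f T" "semi_invariant f R"
  shows "\<exists>l. l \<noteq> 0 \<and> f = pencil l"
proof -
  obtain a b c where abc: "\<And>x. peval f (S *v x) = a * peval f x" "\<And>x. peval f (T *v x) = b * peval f x"
    "\<And>x. peval f (R *v x) = c * peval f x" and "b \<noteq> 0"
    using semi unfolding semi_invariant_def by metis
  let ?e = "vector [1, 0, 0, 0] :: complex^4"
  have fixed: "S *v ?e = ?e" "T *v ?e = ?e" "R *v ?e = ?e" by (simp_all add: S T R klein_map_def)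
  have "peval f ?e \<noteq> 0"
  proof
    assume zero: "peval f ?e = 0"
    define g where "g i = peval (pderiv_wrt i f) ?e" for i
    have "g 1 = 0" unfolding g_def by (rule pderiv_first_axis[OF qf zero])
    have gS: "zeta7 ^ 4 * g 2 = a * g 2" "zeta7 ^ 2 * g 3 = a * g 3" "zeta7 * g 4 = a * g 4"
      using gradient_semi_invariant[OF abc(1), of "axis 2 1" ?e] gradient_semi_invariant[OF abc(1), of "axis 3 1" ?e]
        gradient_semi_invariant[OF abc(1), of "axis 4 1" ?e]
      unfolding fixed g_def[symmetric] by (simp_all add: S sum_4 axis_def)
    have gT: "g 4 = b * g 2" "g 2 = b * g 3" "g 3 = b * g 4"
      using gradient_semi_invariant[OF abc(2), of "axis 2 1" ?e] gradient_semi_invariant[OF abc(2), of "axis 3 1" ?e]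
        gradient_semi_invariant[OF abc(2), of "axis 4 1" ?e]
      unfolding fixed g_def[symmetric] by (simp_all add: T sum_4 axis_def)
    \<comment> \<open>Distinct eigenvalues of S annihilate one component of the gradient; the cyclic
      relations \<open>gT\<close> spread the zero to the others.\<close>
    have "zeta7 ^ 2 \<noteq> zeta7" using zeta7_root by (auto simp: power2_eq_square)
    then have "g 3 = 0 \<or> g 4 = 0" using gS(2,3) by (metis mult_right_cancel)
    then have "g 2 = 0 \<and> g 3 = 0 \<and> g 4 = 0" using gT by (metis mult_zero_right)
    with \<open>g 1 = 0\<close>
    have "g i = 0" for i using exhaust_4[of i] by auto
    then show False using smooth singular_at_first_axis unfolding g_def by blast
  qed
  then have one: "a = 1" "b = 1" "c = 1" using abc[of ?e] fixed by auto
  let ?L = "{(4,0,0,0), (1,1,1,1), (0,3,1,0), (0,0,3,1), (0,1,0,3)} :: (nat \<times> nat \<times> nat \<times> nat) set"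
  have L: "(a', b', c', d') \<in> ?L" if nz: "coef f a' b' c' d' \<noteq> 0" for a' b' c' d'
  proof -
    have sum: "a' + b' + c' + d' = 4" by (rule coef_quartic[OF qf nz])
    have "1 ^ a' * (zeta7 ^ 4) ^ b' * (zeta7 ^ 2) ^ c' * zeta7 ^ d' = 1"
      by (rule coef_diagonal[OF _ nz]) (use abc(1) one in \<open>simp add: S\<close>)
    then have "zeta7 ^ (4 * b' + 2 * c' + d') = 1" by (simp add: power_add power_mult)
    then have m: "(4 * b' + 2 * c' + d') mod 7 = 0" by (rule primitive_root_power[OF primitive_zeta7])
    have "b' = 0 \<or> b' = 1 \<or> b' = 2 \<or> b' = 3 \<or> b' = 4" "c' = 0 \<or> c' = 1 \<or> c' = 2 \<or> c' = 3 \<or> c' = 4"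
      "d' = 0 \<or> d' = 1 \<or> d' = 2 \<or> d' = 3 \<or> d' = 4" "a' = 4 - b' - c' - d'" "b' + c' + d' \<le> 4"
      using sum by auto
    with m show ?thesis by (elim disjE) simp_all
  qed
  define k q g1 g2 g3 where ks: "k = coef f 4 0 0 0" "q = coef f 1 1 1 1" "g1 = coef f 0 3 1 0"
    "g2 = coef f 0 0 3 1" "g3 = coef f 0 1 0 3"
  have F: "peval f (vector [x, y, z, w]) =
      k * x ^ 4 + q * (x * y * z * w) + g1 * (y ^ 3 * z) + g2 * (z ^ 3 * w) + g3 * (y * w ^ 3)" for x y z w
    by (subst peval_supported[OF _ L]) (simp_all add: ks)
  have T1: "peval f (vector [x, z, w, y]) = peval f (vector [x, y, z, w])" for x y z w
    using abc(2)[of "vector [x, y, z, w]"] by (simp add: T one)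
  have g: "g2 = g1" "g3 = g1" using T1[where x=0 and y=0 and z=1 and w=1] T1[where x=0 and y=1 and z=1 and w=0] by (simp_all add: F)
  have "q = 0"
  proof -
    let ?r = "\<i> / rsqrt 7"
    have nz: "u_minus \<noteq> 0" "s_minus \<noteq> 0" "t_minus \<noteq> 0"
    proof -
      obtain d where d: "s_minus = u_minus * d" "t_minus = u_minus * (1 - d ^ 2)" "u_minus ^ 2 = d ^ 2 - 4"
        "d ^ 3 + d ^ 2 - 2 * d - 1 = 0" by (rule minus_numbers)
      show u: "u_minus \<noteq> 0"
      proof
        assume "u_minus = 0"
        then have d2: "d ^ 2 - 4 = 0" using d(3) by simp
        \<comment> \<open>Euclidean division of the cubic by d^2 - 4, continued on the next lines to
          the nonzero remainder 7.\<close>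
        have "2 * d + 3 = (d ^ 3 + d ^ 2 - 2 * d - 1) - (d + 1) * (d ^ 2 - 4)" by algebra
        then have "2 * d + 3 = 0" unfolding d(4) d2 by simp
        moreover have "(2 * d + 3) * (2 * d - 3) = 4 * (d ^ 2 - 4) + 7" by algebra
        then have "(2 * d + 3) * (2 * d - 3) = 7" unfolding d2 by simp
        ultimately show False by simp
      qed
      have "d \<noteq> 0" using d(4) by auto
      then show "s_minus \<noteq> 0" unfolding d(1) using u by simp
      have "1 - d ^ 2 \<noteq> 0"
      proof
        assume d2: "1 - d ^ 2 = 0"
        have "d = - (d ^ 3 + d ^ 2 - 2 * d - 1) - (1 - d ^ 2) * (d + 1)" by algebra
        then have "d = 0" unfolding d(4) d2 by simp
        with \<open>d \<noteq> 0\<close> show False by simp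
      qed
      then show "t_minus \<noteq> 0" unfolding d(2) using u by simp
    qed
    have K: "klein_map (vector [x, 1, 0, 0]) = vector [x, ?r * u_minus, ?r * s_minus, ?r * t_minus]" for x
      by (simp add: klein_map_def)
    have "peval f (vector [x, ?r * u_minus, ?r * s_minus, ?r * t_minus]) = peval f (vector [x, 1, 0, 0])" for x
      using abc(3)[of "vector [x, 1, 0, 0]"] unfolding R K one by simp
    \<comment> \<open>Only the term with q is odd in the first coordinate, and it vanishes at (x, 1,
      0, 0), so the difference of the two instances isolates it at the image points.\<close>
    from this[of 1] this[of "- 1"]
    have "q * (?r * u_minus * (?r * s_minus) * (?r * t_minus)) = 0" unfolding F by algebra
    moreover have "?r \<noteq> 0" by (simp add: rsqrt_def)
    ultimately show "q = 0" using nz by simp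
  qed
  have "f = pencil (vector [k, g1])"
  proof (rule peval_eq_imp_eq)
    fix x :: "complex^4"
    have "peval f (vector [x $ 1, x $ 2, x $ 3, x $ 4]) = peval (pencil (vector [k, g1])) (vector [x $ 1, x $ 2, x $ 3, x $ 4])"
      unfolding F peval_pencil by (simp add: g \<open>q = 0\<close> algebra_simps)
    then show "peval f x = peval (pencil (vector [k, g1])) x" by (simp only: vector_4_eta)
  qed
  moreover have "k \<noteq> 0" using \<open>peval f ?e \<noteq> 0\<close> by (simp add: F)
  then have "(vector [k, g1] :: complex^2) \<noteq> 0" by (metis vector_2(1) zero_index)
  ultimately show ?thesis by blast
qed

section \<open>Singular members of the pencil\<close>

lemma pderiv_pencil:
  "peval (pderiv_wrt 1 (pencil l)) x = 4 * l $ 1 * x $ 1 ^ 3"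
  "peval (pderiv_wrt 2 (pencil l)) x = l $ 2 * (3 * x $ 3 * x $ 2 ^ 2 + x $ 4 ^ 3)"
  "peval (pderiv_wrt 3 (pencil l)) x = l $ 2 * (x $ 2 ^ 3 + 3 * x $ 3 ^ 2 * x $ 4)"
  "peval (pderiv_wrt 4 (pencil l)) x = l $ 2 * (3 * x $ 4 ^ 2 * x $ 2 + x $ 3 ^ 3)"
proof -
  have ax: "x + s *s axis 1 1 = vector [x $ 1 + s, x $ 2, x $ 3, x $ 4]"
    "x + s *s axis 2 1 = vector [x $ 1, x $ 2 + s, x $ 3, x $ 4]"
    "x + s *s axis 3 1 = vector [x $ 1, x $ 2, x $ 3 + s, x $ 4]"
    "x + s *s axis 4 1 = vector [x $ 1, x $ 2, x $ 3, x $ 4 + s]" for s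
    by (simp_all add: vec_eq_iff forall_4 axis_def)
  show "peval (pderiv_wrt 1 (pencil l)) x = 4 * l $ 1 * x $ 1 ^ 3"
    "peval (pderiv_wrt 2 (pencil l)) x = l $ 2 * (3 * x $ 3 * x $ 2 ^ 2 + x $ 4 ^ 3)"
    "peval (pderiv_wrt 3 (pencil l)) x = l $ 2 * (x $ 2 ^ 3 + 3 * x $ 3 ^ 2 * x $ 4)"
    "peval (pderiv_wrt 4 (pencil l)) x = l $ 2 * (3 * x $ 4 ^ 2 * x $ 2 + x $ 3 ^ 3)"
    by (rule peval_pderiv_wrt_eqI, unfold ax peval_pencil,
        auto intro!: derivative_eq_intros simp: algebra_simps)+
qed

text \<open>If both coefficients are nonzero, x_1 = 0, and multiplying the other three equations
  gives p = -27 p for p = (x_2 x_3 x_4)^3; so one coordinate vanishes, and then all do. The two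
  exceptional members are a cone with vertex (1, 0, 0, 0) and a fourfold plane.\<close>

lemma singular_pencil_iff: "singular_form (pencil l) \<longleftrightarrow> l $ 1 = 0 \<or> l $ 2 = 0"
proof
  assume "singular_form (pencil l)"
  then obtain x where x: "x \<noteq> 0" "\<And>i. peval (pderiv_wrt i (pencil l)) x = 0"
    unfolding singular_form_def by blast
  show "l $ 1 = 0 \<or> l $ 2 = 0"
  proof (rule ccontr)
    assume l: "\<not> ?thesis"
    have x1: "x $ 1 = 0" using x(2)[of 1] l unfolding pderiv_pencil by simp
    have e: "3 * x $ 3 * x $ 2 ^ 2 + x $ 4 ^ 3 = 0" "x $ 2 ^ 3 + 3 * x $ 3 ^ 2 * x $ 4 = 0"
      "3 * x $ 4 ^ 2 * x $ 2 + x $ 3 ^ 3 = 0"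
      using x(2)[of 2] x(2)[of 3] x(2)[of 4] l unfolding pderiv_pencil by auto
    have cubes: "x $ 2 ^ 3 = - (3 * x $ 3 ^ 2 * x $ 4)" "x $ 3 ^ 3 = - (3 * x $ 4 ^ 2 * x $ 2)"
      "x $ 4 ^ 3 = - (3 * x $ 3 * x $ 2 ^ 2)"
      using e by (simp_all add: eq_neg_iff_add_eq_0 add.commute)
    have "x $ 2 ^ 3 * x $ 3 ^ 3 * x $ 4 ^ 3 =
        (- (3 * x $ 3 ^ 2 * x $ 4)) * (- (3 * x $ 4 ^ 2 * x $ 2)) * (- (3 * x $ 3 * x $ 2 ^ 2))"
      by (simp only: cubes)
    also have "\<dots> = - 27 * (x $ 2 ^ 3 * x $ 3 ^ 3 * x $ 4 ^ 3)" by algebra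
    finally have "28 * (x $ 2 ^ 3 * x $ 3 ^ 3 * x $ 4 ^ 3) = 0" by simp
    then have "x $ 2 = 0 \<or> x $ 3 = 0 \<or> x $ 4 = 0" by simp
    then have "x $ 2 = 0 \<and> x $ 3 = 0 \<and> x $ 4 = 0" using e by (elim disjE) auto
    with x1 x(1) show False by (simp add: vec_eq_iff forall_4)
  qed
next
  assume l: "l $ 1 = 0 \<or> l $ 2 = 0"
  have grad: "singular_form (pencil l)"
    if x: "x \<noteq> 0" and zero: "peval (pderiv_wrt 1 (pencil l)) x = 0" "peval (pderiv_wrt 2 (pencil l)) x = 0"
      "peval (pderiv_wrt 3 (pencil l)) x = 0" "peval (pderiv_wrt 4 (pencil l)) x = 0" for x
  proof -
    have "peval (pderiv_wrt i (pencil l)) x = 0" for i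
      using zero exhaust_4[of i] by (elim disjE) simp_all
    then show ?thesis using x unfolding singular_form_def by blast
  qed
  show "singular_form (pencil l)"
  proof (cases "l $ 1 = 0")
    case True
    show ?thesis
      by (rule grad[of "vector [1, 0, 0, 0]"]) (simp_all add: vec_eq_iff forall_4 pderiv_pencil True)
  next
    case False
    then have "l $ 2 = 0" using l by simp
    then show ?thesis
      by (intro grad[of "vector [0, 1, 0, 0]"]) (simp_all add: vec_eq_iff forall_4 pderiv_pencil)
  qed
qed

section \<open>The generators\<close>

lemma rsqrt_square: "x \<ge> 0 \<Longrightarrow> rsqrt x ^ 2 = of_real x"
  by (simp add: rsqrt_def flip: of_real_power)

lemma nu_prod: "nu_plus * nu_minus = 1"
proof -
  have "(rsqrt 3 + \<i> * rsqrt 5) * (rsqrt 3 - \<i> * rsqrt 5) = rsqrt 3 ^ 2 + rsqrt 5 ^ 2"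
    by (simp add: algebra_simps power2_eq_square)
  also have "\<dots> = (2 * rsqrt 2) * (2 * rsqrt 2)"
    using rsqrt_square[of 2] rsqrt_square[of 3] rsqrt_square[of 5] by (simp add: power2_eq_square)
  finally show ?thesis
    unfolding nu_plus_def nu_minus_def times_divide_times_eq by (simp add: rsqrt_def)
qed

text \<open>The second claim is what removes the cubic terms in \<open>singular_Q1\<close>.\<close>

lemma lambda_prod: "lambda_plus * lambda_minus = 1" "lambda_minus ^ 3 \<noteq> - 1"
proof -
  have r: "rsqrt 15 ^ 2 = 15" using rsqrt_square[of 15] by simp
  have "(- 1 + \<i> * rsqrt 15) * (- 1 - \<i> * rsqrt 15) = 1 + rsqrt 15 ^ 2"
    by (simp add: algebra_simps power2_eq_square)
  then show prod: "lambda_plus * lambda_minus = 1"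
    unfolding lambda_plus_def lambda_minus_def times_divide_times_eq r by simp
  define m where "m = lambda_minus"
  have "lambda_plus = - 1 / 2 - m" unfolding m_def lambda_plus_def lambda_minus_def by (simp add: field_simps)
  then have "(- 1 / 2 - m) * m = 1" using prod unfolding m_def by simp
  moreover have "2 * m ^ 2 + m + 2 = 2 - 2 * ((- 1 / 2 - m) * m)"
    by (simp add: algebra_simps power2_eq_square)
  ultimately have m: "2 * m ^ 2 + m + 2 = 0" by simp
  have "m ^ 3 + 1 \<noteq> 0"
  proof
    assume a: "m ^ 3 + 1 = 0"
    \<comment> \<open>Division of 4 (m^3 + 1) by the quadratic equation of m; the only candidate m =
      2 gives 12 in the quadratic.\<close>
    have "3 * (m - 2) = (2 * m - 1) * (2 * m ^ 2 + m + 2) - 4 * (m ^ 3 + 1)" by algebra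
    then have "m = 2" unfolding a m by simp
    then show False using m by simp
  qed
  then show "lambda_minus ^ 3 \<noteq> - 1" by (simp add: m_def eq_neg_iff_add_eq_0)
qed

lemma Q41_mult_vec: "Q41 \<omega> *v x = vector [\<omega> * x $ 1, \<omega> * x $ 2, \<omega> ^ 2 * x $ 3, \<omega> ^ 2 * x $ 4]"
  by (simp add: Q41_def mat4_mult_vec)

lemma Q42_mult_vec: "Q42 *v x = (1 / rsqrt 3) *s vector [x $ 1 + rsqrt 2 * x $ 4, x $ 2 + rsqrt 2 * x $ 3,
    rsqrt 2 * x $ 2 - x $ 3, rsqrt 2 * x $ 1 - x $ 4]"
  by (simp add: Q42_def scale_mat_mult_vec mat4_mult_vec)

lemma Q43_mult_vec: "Q43 *v x = vector [nu_plus * x $ 4, nu_plus * x $ 3, nu_minus * x $ 2, nu_minus * x $ 1]"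
  by (simp add: Q43_def mat4_mult_vec)

lemma Q53_mult_vec: "Q53 *v x = vector [nu_plus * x $ 4, nu_minus * x $ 3, nu_plus * x $ 2, nu_minus * x $ 1]"
  by (simp add: Q53_def mat4_mult_vec)

lemma invertible_Q42: "invertible Q42"
proof (rule invertible_if_trivial_kernel)
  fix x assume "Q42 *v x = 0"
  moreover have "rsqrt 3 \<noteq> 0" by (simp add: rsqrt_def)
  ultimately have x: "x $ 1 + rsqrt 2 * x $ 4 = 0" "x $ 2 + rsqrt 2 * x $ 3 = 0"
    "rsqrt 2 * x $ 2 - x $ 3 = 0" "rsqrt 2 * x $ 1 - x $ 4 = 0"
    by (auto simp: Q42_mult_vec vec_eq_iff forall_4)
  have r: "rsqrt 2 * rsqrt 2 = 2"
    using rsqrt_square[of 2] by (simp add: power2_eq_square)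
  \<comment> \<open>Without its scalar the matrix has square 3; these are the first two rows of that
    square.\<close>
  have "3 * x $ 1 = (x $ 1 + rsqrt 2 * x $ 4) + rsqrt 2 * (rsqrt 2 * x $ 1 - x $ 4)"
    "3 * x $ 2 = (x $ 2 + rsqrt 2 * x $ 3) + rsqrt 2 * (rsqrt 2 * x $ 2 - x $ 3)"
    by (simp_all add: algebra_simps r)
  then have "x $ 1 = 0" "x $ 2 = 0" unfolding x by simp_all
  with x show "x = 0" by (simp add: vec_eq_iff forall_4)
qed

text \<open>Stated for any generating set containing the three matrices, so that it covers (R_3) and
  (Q_7) whatever their fourth generator is.\<close>

lemma no_smooth_Q4_Q5:
  assumes \<omega>: "primitive_root_of_unity 3 \<omega>" and S: "Q41 \<omega> \<in> S" "Q42 \<in> S" "Q43 \<in> S \<or> Q53 \<in> S"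
  shows "\<not> (\<exists>f. smooth_quartic f \<and> invariant_under (pgl_generated S) (surface f))"
proof
  assume "\<exists>f. smooth_quartic f \<and> invariant_under (pgl_generated S) (surface f)"
  then obtain f where f: "smooth_quartic f" and inv: "invariant_under (pgl_generated S) (surface f)" by blast
  have qf: "quartic_form f" using f by (simp add: smooth_quartic_def)
  note semi = semi_invariant_if_surface_invariant[OF f inv]
  have "invertible (Q41 \<omega>)"
    by (rule invertible_if_trivial_kernel)
      (use primitive_cube_root(5)[OF \<omega>] in \<open>auto simp: Q41_mult_vec vec_eq_iff forall_4\<close>)
  then obtain k where k: "k \<noteq> 0" "\<And>x. peval f (Q41 \<omega> *v x) = k * peval f x"
    using semi S(1) unfolding semi_invariant_def by blast
  obtain l where l: "\<And>x. peval f (Q42 *v x) = l * peval f x"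
    using semi[OF S(2) invertible_Q42] unfolding semi_invariant_def by blast
  have nu: "nu_plus \<noteq> 0" "nu_minus \<noteq> 0" using nu_prod by auto
  have "invertible Q43" "invertible Q53"
    by (rule invertible_if_trivial_kernel, use nu in \<open>auto simp: Q43_mult_vec Q53_mult_vec vec_eq_iff forall_4\<close>)+
  then have "semi_invariant f Q43 \<or> semi_invariant f Q53" using semi S(3) by blast
  \<comment> \<open>Both candidates are antidiagonal, and only this shape matters.\<close>
  then obtain \<alpha> \<beta> \<gamma> \<delta> m where N: "m \<noteq> 0"
    "\<And>x. peval f (vector [\<alpha> * x $ 4, \<beta> * x $ 3, \<gamma> * x $ 2, \<delta> * x $ 1]) = m * peval f x"
    unfolding semi_invariant_def Q43_mult_vec Q53_mult_vec by blast
  have "peval f (vector [x $ 1 + rsqrt 2 * x $ 4, x $ 2 + rsqrt 2 * x $ 3, rsqrt 2 * x $ 2 - x $ 3, rsqrt 2 * x $ 1 - x $ 4])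
      = rsqrt 3 ^ 4 * l * peval f x" for x
    using l[of x] unfolding Q42_mult_vec quartic_form_scale[OF qf]
    by (simp add: power_divide field_simps rsqrt_def)
  moreover have "rsqrt 2 ^ 2 = 2" using rsqrt_square[of 2] by simp
  ultimately have "singular_form f"
    using singular_Q4_Q5[OF qf \<omega> k(2)[unfolded Q41_mult_vec] k(1) _ _ N(2,1)] by blast
  then show False using f by (simp add: smooth_quartic_def)
qed

lemma no_smooth_Q1:
  assumes \<omega>: "primitive_root_of_unity 3 \<omega>"
  shows "\<not> (\<exists>f. smooth_quartic f \<and> invariant_under (group_Q1 \<omega>) (surface f))"
proof
  assume "\<exists>f. smooth_quartic f \<and> invariant_under (group_Q1 \<omega>) (surface f)"
  then obtain f where f: "smooth_quartic f" and inv: "invariant_under (group_Q1 \<omega>) (surface f)" by blast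
  have qf: "quartic_form f" using f by (simp add: smooth_quartic_def)
  define A where "A = mat4 [1, 0, 0, 0] [0, 1, 0, 0] [0, 0, \<omega>, 0] [0, 0, 0, \<omega> ^ 2]"
  define B where "B = mat4 [1, 0, 0, 0] [0, - (1/3), 2/3, 2/3] [0, 2/3, - (1/3), 2/3] [0, 2/3, 2/3, - (1/3)]"
  define C where "C = mat4 [1, 0, 0, 0] [0, - 1, 0, 0] [0, 0, 0, lambda_plus] [0, 0, lambda_minus, 0]"
  have A: "A *v x = vector [x $ 1, x $ 2, \<omega> * x $ 3, \<omega> ^ 2 * x $ 4]" for x
    by (simp add: A_def mat4_mult_vec)
  have B: "B *v x = vector [x $ 1, (- x $ 2 + 2 * x $ 3 + 2 * x $ 4) / 3,
      (2 * x $ 2 - x $ 3 + 2 * x $ 4) / 3, (2 * x $ 2 + 2 * x $ 3 - x $ 4) / 3]" for x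
    by (simp add: B_def mat4_mult_vec add_divide_distrib diff_divide_distrib)
  have C: "C *v x = vector [x $ 1, - x $ 2, lambda_plus * x $ 4, lambda_minus * x $ 3]" for x
    by (simp add: C_def mat4_mult_vec)
  have "B *v (B *v x) = x" for x unfolding B vec_eq_iff forall_4 vector_4_nth by (simp add: field_simps)
  then have "invertible B" by (metis invertible_if_trivial_kernel matrix_vector_mult_0_right)
  moreover have "invertible A"
    by (rule invertible_if_trivial_kernel)
      (use primitive_cube_root(5)[OF \<omega>] in \<open>auto simp: A vec_eq_iff forall_4\<close>)
  moreover have "lambda_plus \<noteq> 0" "lambda_minus \<noteq> 0" using lambda_prod(1) by auto
  then have "invertible C"
    by (intro invertible_if_trivial_kernel) (auto simp: C vec_eq_iff forall_4)
  ultimately have "semi_invariant f A" "semi_invariant f B" "semi_invariant f C"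
    using semi_invariant_if_surface_invariant[OF f inv[unfolded group_Q1_def, folded A_def B_def C_def]] by auto
  then have "singular_form f" by (rule singular_Q1[OF qf \<omega> A B C lambda_prod])
  then show False using f by (simp add: smooth_quartic_def)
qed

definition klein_S :: "complex^4^4" where
  "klein_S = mat4 [1, 0, 0, 0] [0, zeta7 ^ 4, 0, 0] [0, 0, zeta7 ^ 2, 0] [0, 0, 0, zeta7]"

definition klein_T :: "complex^4^4" where
  "klein_T = mat4 [1, 0, 0, 0] [0, 0, 1, 0] [0, 0, 0, 1] [0, 1, 0, 0]"

definition klein_R :: "complex^4^4" where
  "klein_R = scale_mat (\<i> / rsqrt 7) (mat4 [- (\<i> * rsqrt 7), 0, 0, 0] [0, u_minus, s_minus, t_minus]
     [0, s_minus, t_minus, u_minus] [0, t_minus, u_minus, s_minus])"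

lemma group_P_eq: "group_P = pgl_generated {klein_S, klein_T, klein_R}"
  unfolding group_P_def klein_S_def klein_T_def klein_R_def ..

lemma klein_S_mult_vec:
  "klein_S *v x = vector [x $ 1, zeta7 ^ 4 * x $ 2, zeta7 ^ 2 * x $ 3, zeta7 * x $ 4]"
  by (simp add: klein_S_def mat4_mult_vec)

lemma klein_T_mult_vec: "klein_T *v x = vector [x $ 1, x $ 3, x $ 4, x $ 2]"
  by (simp add: klein_T_def mat4_mult_vec)

lemma klein_R_mult_vec: "klein_R *v x = klein_map x"
proof -
  have "\<i> / rsqrt 7 * - (\<i> * rsqrt 7) = 1" by (simp add: rsqrt_def)
  then have "\<i> / rsqrt 7 * (- (\<i> * rsqrt 7) * x $ 1) = x $ 1" by (simp only: mult.assoc[symmetric]) simp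
  then show ?thesis
    by (simp add: klein_R_def klein_map_def scale_mat_mult_vec mat4_mult_vec vec_eq_iff forall_4)
qed

lemma invertible_klein: "A \<in> {klein_S, klein_T, klein_R} \<Longrightarrow> invertible A"
proof (rule invertible_if_trivial_kernel)
  fix x assume A: "A \<in> {klein_S, klein_T, klein_R}" and zero: "A *v x = 0"
  have z: "zeta7 \<noteq> 0" using zeta7_root(1) by auto
  have "x = 0" if "klein_map x = 0"
  proof -
    have "x = klein_map 0" using klein_map_involution[of x] that by simp
    then show ?thesis by (simp add: klein_map_def vec_eq_iff forall_4)
  qed
  then show "x = 0" using A zero z
    by (auto simp: klein_S_mult_vec klein_T_mult_vec klein_R_mult_vec) (auto simp: vec_eq_iff forall_4)
qed

lemma surface_pencil_invariant:
  assumes "l \<noteq> 0"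
  shows "invariant_under group_P (surface (pencil l))"
  unfolding group_P_eq
proof (rule surface_invariant_if_semi_invariant[OF quartic_form_pencil[OF assms]])
  fix A assume A: "A \<in> {klein_S, klein_T, klein_R}"
  have z: "zeta7 ^ 7 = 1" by (rule zeta7_root)
  have "peval (pencil l) (vector [x $ 1, zeta7 ^ 4 * x $ 2, zeta7 ^ 2 * x $ 3, zeta7 * x $ 4])
      = peval (pencil l) (vector [x $ 1, x $ 2, x $ 3, x $ 4])" for x :: "complex^4"
    unfolding peval_pencil using z by algebra
  moreover have "peval (pencil l) (vector [x $ 1, x $ 3, x $ 4, x $ 2])
      = peval (pencil l) (vector [x $ 1, x $ 2, x $ 3, x $ 4])" for x :: "complex^4"
    unfolding peval_pencil by algebra
  ultimately have "peval (pencil l) (A *v x) = peval (pencil l) x" for x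
    using A by (auto simp: klein_S_mult_vec klein_T_mult_vec klein_R_mult_vec vector_4_eta peval_pencil_klein_map)
  then have "semi_invariant (pencil l) A" unfolding semi_invariant_def by (intro exI[of _ 1]) simp
  then show "invertible A \<and> semi_invariant (pencil l) A" using A invertible_klein by blast
qed

lemma smooth_invariant_P_in_pencil:
  assumes f: "smooth_quartic f" and inv: "invariant_under group_P (surface f)"
  shows "\<exists>l. l \<noteq> 0 \<and> f = pencil l"
proof -
  note semi = semi_invariant_if_surface_invariant[OF f inv[unfolded group_P_eq]]
  have "semi_invariant f klein_S" "semi_invariant f klein_T" "semi_invariant f klein_R"
    by (rule semi; simp add: invertible_klein)+
  moreover have "quartic_form f" "\<not> singular_form f" using f by (simp_all add: smooth_quartic_def)
  ultimately show ?thesis using pencil_if_semi_invariant[OF _ _ klein_S_mult_vec klein_T_mult_vec klein_R_mult_vec] by blast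
qed

lemma proj_point_axes:
  fixes l :: "complex^2"
  assumes "l \<noteq> 0"
  shows "proj_point l \<in> {proj_point (vector [1, 0]), proj_point (vector [0, 1])} \<longleftrightarrow> l $ 1 = 0 \<or> l $ 2 = 0"
proof
  assume "proj_point l \<in> {proj_point (vector [1, 0]), proj_point (vector [0, 1])}"
  then obtain c where "l = c *s vector [1, 0] \<or> l = c *s vector [0, 1]"
    using mem_proj_point[of l] by (auto simp: proj_point_def)
  then show "l $ 1 = 0 \<or> l $ 2 = 0" by auto
next
  assume *: "l $ 1 = 0 \<or> l $ 2 = 0"
  have scale: "proj_point (c *s v) = proj_point v" if c: "c \<noteq> 0" for c and v :: "complex^2"
  proof (intro equalityI subsetI)
    fix y assume "y \<in> proj_point (c *s v)"
    then obtain a where "y = a *s (c *s v)" "a \<noteq> 0" by (auto simp: proj_point_def)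
    then show "y \<in> proj_point v" using c by (auto simp: proj_point_def intro!: exI[of _ "a * c"])
  next
    fix y assume "y \<in> proj_point v"
    then obtain a where "y = a *s v" "a \<noteq> 0" by (auto simp: proj_point_def)
    then show "y \<in> proj_point (c *s v)" using c by (auto simp: proj_point_def intro!: exI[of _ "a / c"])
  qed
  show "proj_point l \<in> {proj_point (vector [1, 0]), proj_point (vector [0, 1])}"
  proof (cases "l $ 1 = 0")
    case True
    then have "l = l $ 2 *s vector [0, 1]" "l $ 2 \<noteq> 0" using assms by (auto simp: vec_eq_iff forall_2)
    then show ?thesis using scale by (metis insertCI)
  next
    case False
    then have "l = l $ 1 *s vector [1, 0]" using * by (auto simp: vec_eq_iff forall_2)
    then show ?thesis using scale False by (metis insertCI)
  qed
qed

theorem theorem8p6: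
  fixes \<omega> :: complex
  assumes "primitive_root_of_unity 3 \<omega>"
  shows "{G \<in> {group_Q1 \<omega>, group_Q4 \<omega>, group_Q5 \<omega>, group_R3 \<omega>, group_Q7 \<omega>, group_P}.
            \<exists>f. smooth_quartic f \<and> invariant_under G (surface f)} = {group_P}
    \<and> (\<forall>f. smooth_quartic f \<and> invariant_under group_P (surface f)
          \<longrightarrow> (\<exists>l :: complex^2. l \<noteq> 0 \<and> f = pencil l))
    \<and> (\<forall>l :: complex^2. l \<noteq> 0 \<longrightarrow>
          (singular_form (pencil l)
           \<longleftrightarrow> proj_point l \<in> {proj_point (vector [1, 0]), proj_point (vector [0, 1])}))"
proof (intro conjI allI impI)
  let ?has = "\<lambda>G. \<exists>f. smooth_quartic f \<and> invariant_under G (surface f)"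
  have none: "\<not> ?has (group_Q1 \<omega>)" "\<not> ?has (group_Q4 \<omega>)" "\<not> ?has (group_Q5 \<omega>)"
    "\<not> ?has (group_R3 \<omega>)" "\<not> ?has (group_Q7 \<omega>)"
    unfolding group_Q4_def group_Q5_def group_R3_def group_Q7_def
    by (rule no_smooth_Q1[OF assms] no_smooth_Q4_Q5[OF assms]; simp)+
  \<comment> \<open>Any member with both coordinates nonzero is a smooth witness for (P).\<close>
  define l :: "complex^2" where "l = vector [1, 1]"
  have l: "l $ 1 = 1" "l $ 2 = 1" by (simp_all add: l_def)
  then have "l \<noteq> 0" by (metis zero_index zero_neq_one)
  then have "smooth_quartic (pencil l)" "invariant_under group_P (surface (pencil l))"
    by (simp_all add: smooth_quartic_def quartic_form_pencil singular_pencil_iff l surface_pencil_invariant)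
  then have "?has group_P" by blast
  with none show "{G \<in> {group_Q1 \<omega>, group_Q4 \<omega>, group_Q5 \<omega>, group_R3 \<omega>, group_Q7 \<omega>, group_P}. ?has G} = {group_P}"
    by blast
next
  fix f assume "smooth_quartic f \<and> invariant_under group_P (surface f)"
  then show "\<exists>l :: complex^2. l \<noteq> 0 \<and> f = pencil l" using smooth_invariant_P_in_pencil by blast
next
  fix l :: "complex^2" assume "l \<noteq> 0"
  show "singular_form (pencil l) \<longleftrightarrow>
      proj_point l \<in> {proj_point (vector [1, 0]), proj_point (vector [0, 1])}"
    by (simp only: singular_pencil_iff proj_point_axes[OF \<open>l \<noteq> 0\<close>])
qed

end
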